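(* Let $G$ and $H$ be CSA$^\ast$-groups and let $\phi:A\to B$ be an isomorphism of nontrivial abelian subgroups $A\le G$ and $B\le H$. Then the amalgamated product $G\ast_\phi H$ is a CSA$^\ast$-group if and only if $A$ is maximal abelian in $G$ or $B$ is maximal abelian in $H$.
   Context: A subgroup $K$ of a group $G$ is malnormal if $K\cap x^{-1}Kx=1$ for all $x\in G\setminus K$. A group is a CSA-group if all its maximal abelian subgroups are malnormal. A CSA$^\ast$-group is a CSA-group without elements of order 2. $G\ast_\phi H$ denotes the free product of $G$ and $H$ with $a$ identified with $\phi(a)$ for all $a\in A$. *)

theory Defs
  imports "HOL-Algebra.Algebra"
begin

definition malnormal :: "'a set \<Rightarrow> ('a, 'm) monoid_scheme \<Rightarrow> bool" where
  "malnormal K G \<longleftrightarrow> subgroup K G \<and>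
     (\<forall>x \<in> carrier G - K. K \<inter> (inv\<^bsub>G\<^esub> x <#\<^bsub>G\<^esub> (K #>\<^bsub>G\<^esub> x)) = {\<one>\<^bsub>G\<^esub>})"

definition comm_subgroup :: "'a set \<Rightarrow> ('a, 'm) monoid_scheme \<Rightarrow> bool" where
  "comm_subgroup K G \<longleftrightarrow> subgroup K G \<and> comm_group (G\<lparr>carrier := K\<rparr>)"

definition maximal_abelian :: "'a set \<Rightarrow> ('a, 'm) monoid_scheme \<Rightarrow> bool" where
  "maximal_abelian K G \<longleftrightarrow> comm_subgroup K G \<and>
     (\<forall>L. comm_subgroup L G \<and> K \<subseteq> L \<longrightarrow> L = K)"

definition CSA_group :: "('a, 'm) monoid_scheme \<Rightarrow> bool" where
  "CSA_group G \<longleftrightarrow> group G \<and> (\<forall>K. maximal_abelian K G \<longrightarrow> malnormal K G)"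

definition CSA_star_group :: "('a, 'm) monoid_scheme \<Rightarrow> bool" where
  "CSA_star_group G \<longleftrightarrow> CSA_group G \<and> \<not> (\<exists>x \<in> carrier G. group.ord G x = 2)"

text \<open>
  The amalgamated product is the quotient of the monoid of words over the disjoint union of
  the two carriers by the congruence generated by the two multiplication tables and by the
  identification of each \<open>a \<in> A\<close> with \<open>\<phi> a\<close>. Inverse letters are not needed, since the
  letters of a word already include the inverses of all group elements.
\<close>

definition amalg_words ::
    "('a, 'm) monoid_scheme \<Rightarrow> ('b, 'n) monoid_scheme \<Rightarrow> ('a + 'b) list set" where
  "amalg_words G H = lists (Inl ` carrier G \<union> Inr ` carrier H)"

lemma amalg_words_simps [simp]:
  "[] \<in> amalg_words G H"
  "Inl x # w \<in> amalg_words G H \<longleftrightarrow> x \<in> carrier G \<and> w \<in> amalg_words G H"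
  "Inr y # w \<in> amalg_words G H \<longleftrightarrow> y \<in> carrier H \<and> w \<in> amalg_words G H"
  "u @ v \<in> amalg_words G H \<longleftrightarrow> u \<in> amalg_words G H \<and> v \<in> amalg_words G H"
  by (auto simp: amalg_words_def)

inductive amalg_eq ::
    "('a, 'm) monoid_scheme \<Rightarrow> ('b, 'n) monoid_scheme \<Rightarrow> 'a set \<Rightarrow> ('a \<Rightarrow> 'b) \<Rightarrow>
     ('a + 'b) list \<Rightarrow> ('a + 'b) list \<Rightarrow> bool"
  for G H A \<phi> where
  refl: "w \<in> amalg_words G H \<Longrightarrow> amalg_eq G H A \<phi> w w"
| sym: "amalg_eq G H A \<phi> u v \<Longrightarrow> amalg_eq G H A \<phi> v u"
| trans: "amalg_eq G H A \<phi> u v \<Longrightarrow> amalg_eq G H A \<phi> v w \<Longrightarrow> amalg_eq G H A \<phi> u w"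
| append: "amalg_eq G H A \<phi> u u' \<Longrightarrow> amalg_eq G H A \<phi> v v' \<Longrightarrow>
    amalg_eq G H A \<phi> (u @ v) (u' @ v')"
| one_left: "amalg_eq G H A \<phi> [Inl \<one>\<^bsub>G\<^esub>] []"
| one_right: "amalg_eq G H A \<phi> [Inr \<one>\<^bsub>H\<^esub>] []"
| mult_left: "x \<in> carrier G \<Longrightarrow> y \<in> carrier G \<Longrightarrow>
    amalg_eq G H A \<phi> [Inl x, Inl y] [Inl (x \<otimes>\<^bsub>G\<^esub> y)]"
| mult_right: "x \<in> carrier H \<Longrightarrow> y \<in> carrier H \<Longrightarrow>
    amalg_eq G H A \<phi> [Inr x, Inr y] [Inr (x \<otimes>\<^bsub>H\<^esub> y)]"
| amalg: "a \<in> A \<Longrightarrow> amalg_eq G H A \<phi> [Inl a] [Inr (\<phi> a)]"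

definition amalg_class ::
    "('a, 'm) monoid_scheme \<Rightarrow> ('b, 'n) monoid_scheme \<Rightarrow> 'a set \<Rightarrow> ('a \<Rightarrow> 'b) \<Rightarrow>
     ('a + 'b) list \<Rightarrow> ('a + 'b) list set" where
  "amalg_class G H A \<phi> w = {v. amalg_eq G H A \<phi> w v}"

definition amalgamated_product ::
    "('a, 'm) monoid_scheme \<Rightarrow> ('b, 'n) monoid_scheme \<Rightarrow> 'a set \<Rightarrow> ('a \<Rightarrow> 'b) \<Rightarrow>
     ('a + 'b) list set monoid" where
  "amalgamated_product G H A \<phi> = \<lparr>
     carrier = amalg_class G H A \<phi> ` amalg_words G H,
     monoid.mult = (\<lambda>P Q. \<Union>u\<in>P. \<Union>v\<in>Q. amalg_class G H A \<phi> (u @ v)),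
     monoid.one = amalg_class G H A \<phi> []\<rparr>"

locale amalgam = G: group G + H: group H
  for G :: "('a, 'm) monoid_scheme" and H :: "('b, 'n) monoid_scheme" +
  fixes A :: "'a set" and \<phi> :: "'a \<Rightarrow> 'b"
  assumes A_subset: "A \<subseteq> carrier G" and \<phi>_closed: "\<phi> ` A \<subseteq> carrier H"
begin

abbreviation "W \<equiv> amalg_words G H"
abbreviation "cls \<equiv> amalg_class G H A \<phi>"
abbreviation "P \<equiv> amalgamated_product G H A \<phi>"

lemma amalg_eq_words:
  assumes "amalg_eq G H A \<phi> u v"
  shows "u \<in> W \<and> v \<in> W"
  using assms
proof induction
  case (amalg a)
  then show ?case using A_subset \<phi>_closed by auto
qed auto

lemma cls_eq_iff: "u \<in> W \<Longrightarrow> cls u = cls v \<longleftrightarrow> amalg_eq G H A \<phi> u v"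
  unfolding amalg_class_def set_eq_iff mem_Collect_eq
  by (metis amalg_eq.refl amalg_eq.sym amalg_eq.trans)

lemma mult_cls:
  assumes "u \<in> W" "v \<in> W"
  shows "cls u \<otimes>\<^bsub>P\<^esub> cls v = cls (u @ v)"
proof -
  have "cls (u' @ v') = cls (u @ v)" if "u' \<in> cls u" "v' \<in> cls v" for u' v'
  proof -
    have "amalg_eq G H A \<phi> (u' @ v') (u @ v)"
      using that by (simp add: amalg_class_def amalg_eq.append amalg_eq.sym)
    then show ?thesis
      using cls_eq_iff[of "u' @ v'" "u @ v"] amalg_eq_words[of "u' @ v'" "u @ v"] by simp
  qed
  then have "(\<Union>u'\<in>cls u. \<Union>v'\<in>cls v. cls (u' @ v')) = (\<Union>u'\<in>cls u. \<Union>v'\<in>cls v. cls (u @ v))"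
    by (intro SUP_cong) auto
  moreover have "u \<in> cls u" "v \<in> cls v"
    using assms by (simp_all add: amalg_class_def amalg_eq.refl)
  ultimately have "(\<Union>u'\<in>cls u. \<Union>v'\<in>cls v. cls (u' @ v')) = cls (u @ v)"
    by auto
  then show ?thesis
    by (simp add: amalgamated_product_def)
qed

lemma carrier_P: "carrier P = cls ` W"
  by (simp add: amalgamated_product_def)

lemma one_P: "\<one>\<^bsub>P\<^esub> = cls []"
  by (simp add: amalgamated_product_def)

lemma word_left_inverse: "w \<in> W \<Longrightarrow> \<exists>v \<in> W. amalg_eq G H A \<phi> (v @ w) []"
proof (induction w)
  case Nil
  then show ?case
    by (intro bexI[of _ "[]"]) (auto intro: amalg_eq.refl)
next
  case (Cons s w)
  then have w: "w \<in> W"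
    by (simp add: amalg_words_def)
  with Cons.IH obtain v where v: "v \<in> W" "amalg_eq G H A \<phi> (v @ w) []"
    by blast
  obtain t where t: "[t] \<in> W" "amalg_eq G H A \<phi> [t, s] []"
  proof (cases s)
    case (Inl x)
    with Cons.prems have "x \<in> carrier G" by auto
    then have "amalg_eq G H A \<phi> [Inl (inv\<^bsub>G\<^esub> x), Inl x] [Inl \<one>\<^bsub>G\<^esub>]"
      using amalg_eq.mult_left[of "inv\<^bsub>G\<^esub> x" G x] by simp
    then have "amalg_eq G H A \<phi> [Inl (inv\<^bsub>G\<^esub> x), Inl x] []"
      by (rule amalg_eq.trans[OF _ amalg_eq.one_left])
    then show thesis
      using that[of "Inl (inv\<^bsub>G\<^esub> x)"] Inl \<open>x \<in> carrier G\<close> by simp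
  next
    case (Inr x)
    with Cons.prems have "x \<in> carrier H" by auto
    then have "amalg_eq G H A \<phi> [Inr (inv\<^bsub>H\<^esub> x), Inr x] [Inr \<one>\<^bsub>H\<^esub>]"
      using amalg_eq.mult_right[of "inv\<^bsub>H\<^esub> x" H x] by simp
    then have "amalg_eq G H A \<phi> [Inr (inv\<^bsub>H\<^esub> x), Inr x] []"
      by (rule amalg_eq.trans[OF _ amalg_eq.one_right])
    then show thesis
      using that[of "Inr (inv\<^bsub>H\<^esub> x)"] Inr \<open>x \<in> carrier H\<close> by simp
  qed
  have "amalg_eq G H A \<phi> (v @ [t, s] @ w) (v @ [] @ w)"
    by (intro amalg_eq.append amalg_eq.refl t v w)
  then have "amalg_eq G H A \<phi> ((v @ [t]) @ s # w) (v @ w)"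
    by simp
  then have "amalg_eq G H A \<phi> ((v @ [t]) @ s # w) []"
    using v(2) by (rule amalg_eq.trans)
  moreover have "v @ [t] \<in> W"
    using v(1) t(1) by simp
  ultimately show ?case by blast
qed

lemma group_P: "group P"
proof (rule groupI)
  show "x \<otimes>\<^bsub>P\<^esub> y \<in> carrier P" if "x \<in> carrier P" "y \<in> carrier P" for x y
  proof -
    from that obtain u v where "x = cls u" "y = cls v" "u \<in> W" "v \<in> W"
      unfolding carrier_P by blast
    moreover from this have "u @ v \<in> W" by simp
    ultimately show ?thesis
      unfolding carrier_P by (metis mult_cls image_eqI)
  qed
  show "\<one>\<^bsub>P\<^esub> \<in> carrier P"
    unfolding carrier_P one_P by simp
  show "x \<otimes>\<^bsub>P\<^esub> y \<otimes>\<^bsub>P\<^esub> z = x \<otimes>\<^bsub>P\<^esub> (y \<otimes>\<^bsub>P\<^esub> z)"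
    if "x \<in> carrier P" "y \<in> carrier P" "z \<in> carrier P" for x y z
    using that unfolding carrier_P by (auto simp: mult_cls)
  show "\<one>\<^bsub>P\<^esub> \<otimes>\<^bsub>P\<^esub> x = x" if "x \<in> carrier P" for x
    using that unfolding carrier_P one_P by (auto simp: mult_cls)
  show "\<exists>y\<in>carrier P. y \<otimes>\<^bsub>P\<^esub> x = \<one>\<^bsub>P\<^esub>" if "x \<in> carrier P" for x
  proof -
    from that obtain w where w: "x = cls w" "w \<in> W"
      unfolding carrier_P by blast
    then obtain v where v: "v \<in> W" "amalg_eq G H A \<phi> (v @ w) []"
      using word_left_inverse by blast
    then have "cls v \<otimes>\<^bsub>P\<^esub> x = \<one>\<^bsub>P\<^esub>"
      using w cls_eq_iff[of "v @ w" "[]"] by (simp add: mult_cls one_P)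
    then show ?thesis
      using v unfolding carrier_P by blast
  qed
qed

lemma inl_hom: "(\<lambda>x. cls [Inl x]) \<in> hom G P"
proof (rule homI)
  show "cls [Inl x] \<in> carrier P" if "x \<in> carrier G" for x
    using that unfolding carrier_P by simp
  show "cls [Inl (x \<otimes>\<^bsub>G\<^esub> y)] = cls [Inl x] \<otimes>\<^bsub>P\<^esub> cls [Inl y]"
    if "x \<in> carrier G" "y \<in> carrier G" for x y
    using that by (simp add: mult_cls cls_eq_iff) (blast intro: amalg_eq.sym amalg_eq.mult_left)
qed

lemma inr_hom: "(\<lambda>x. cls [Inr x]) \<in> hom H P"
proof (rule homI)
  show "cls [Inr x] \<in> carrier P" if "x \<in> carrier H" for x
    using that unfolding carrier_P by simp
  show "cls [Inr (x \<otimes>\<^bsub>H\<^esub> y)] = cls [Inr x] \<otimes>\<^bsub>P\<^esub> cls [Inr y]"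
    if "x \<in> carrier H" "y \<in> carrier H" for x y
    using that by (simp add: mult_cls cls_eq_iff) (blast intro: amalg_eq.sym amalg_eq.mult_right)
qed

lemma inl_eq_inr: "a \<in> A \<Longrightarrow> cls [Inl a] = cls [Inr (\<phi> a)]"
  using A_subset by (subst cls_eq_iff) (auto intro: amalg_eq.amalg)

theorem universal_property:
  fixes K :: "('c, 'k) monoid_scheme"
  assumes K: "group K" and f: "f \<in> hom G K" and g: "g \<in> hom H K"
    and fg: "\<And>a. a \<in> A \<Longrightarrow> f a = g (\<phi> a)"
  shows "\<exists>!h. h \<in> extensional (carrier P) \<inter> hom P K \<and>
           (\<forall>x \<in> carrier G. h (cls [Inl x]) = f x) \<and> (\<forall>y \<in> carrier H. h (cls [Inr y]) = g y)"
proof -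
  interpret K: group K by fact
  define ev where "ev w = foldr (\<lambda>s k. case_sum f g s \<otimes>\<^bsub>K\<^esub> k) w \<one>\<^bsub>K\<^esub>" for w
  have fc: "f x \<in> carrier K" if "x \<in> carrier G" for x
    using f that by (auto simp: hom_def)
  have gc: "g x \<in> carrier K" if "x \<in> carrier H" for x
    using g that by (auto simp: hom_def)
  have ev_closed: "w \<in> W \<Longrightarrow> ev w \<in> carrier K" for w
    by (induction w) (auto simp: ev_def fc gc amalg_words_def)
  have ev_append: "u \<in> W \<Longrightarrow> v \<in> W \<Longrightarrow> ev (u @ v) = ev u \<otimes>\<^bsub>K\<^esub> ev v" for u v
  proof (induction u)
    case Nil
    then show ?case using ev_closed[of v] by (simp add: ev_def)
  next
    case (Cons s u)
    then have "case_sum f g s \<in> carrier K" "u \<in> W" by (auto simp: fc gc amalg_words_def)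
    then show ?case
      using Cons ev_closed[of u] ev_closed[of v] by (simp add: ev_def K.m_assoc)
  qed
  have ev_eq: "amalg_eq G H A \<phi> u v \<Longrightarrow> ev u = ev v" for u v
  proof (induction rule: amalg_eq.induct)
    case (append u u' v v')
    have "u \<in> W" "u' \<in> W" "v \<in> W" "v' \<in> W"
      using amalg_eq_words append.hyps by auto
    with append.IH show ?case by (simp add: ev_append)
  next
    case one_left
    show ?case using hom_one[OF f] K by (simp add: ev_def)
  next
    case one_right
    show ?case using hom_one[OF g] K by (simp add: ev_def)
  next
    case (mult_left x y)
    then show ?case using f by (simp add: ev_def fc hom_mult)
  next
    case (mult_right x y)
    then show ?case using g by (simp add: ev_def gc hom_mult)
  next
    case (amalg a)
    then show ?case using fg by (simp add: ev_def)
  qed auto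
  define h where "h = (\<lambda>p \<in> carrier P. ev (SOME w. w \<in> p))"
  have h_cls: "h (cls w) = ev w" if "w \<in> W" for w
  proof -
    have "w \<in> cls w" using that by (simp add: amalg_class_def amalg_eq.refl)
    then have "(SOME v. v \<in> cls w) \<in> cls w" by (rule someI)
    then have "ev (SOME v. v \<in> cls w) = ev w"
      by (simp add: amalg_class_def ev_eq)
    then show ?thesis using that by (simp add: h_def carrier_P)
  qed
  have h_hom: "h \<in> hom P K"
  proof (rule homI; unfold carrier_P; elim imageE)
    show "h p \<in> carrier K" if "p = cls u" "u \<in> W" for p u
      using that by (simp add: h_cls ev_closed)
    show "h (p \<otimes>\<^bsub>P\<^esub> q) = h p \<otimes>\<^bsub>K\<^esub> h q"
      if "p = cls u" "u \<in> W" "q = cls v" "v \<in> W" for p q u v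
      using that by (simp add: h_cls ev_append mult_cls)
  qed
  show ?thesis
  proof (rule ex1I)
    show "h \<in> extensional (carrier P) \<inter> hom P K \<and>
      (\<forall>x \<in> carrier G. h (cls [Inl x]) = f x) \<and> (\<forall>y \<in> carrier H. h (cls [Inr y]) = g y)"
    proof (intro conjI ballI IntI)
      show "h \<in> extensional (carrier P)" by (simp add: h_def)
      show "h \<in> hom P K" by (fact h_hom)
      show "h (cls [Inl x]) = f x" if "x \<in> carrier G" for x
        using that h_cls[of "[Inl x]"] fc by (simp add: ev_def)
      show "h (cls [Inr y]) = g y" if "y \<in> carrier H" for y
        using that h_cls[of "[Inr y]"] gc by (simp add: ev_def)
    qed
  next
    fix h'
    assume h': "h' \<in> extensional (carrier P) \<inter> hom P K \<and>
      (\<forall>x \<in> carrier G. h' (cls [Inl x]) = f x) \<and> (\<forall>y \<in> carrier H. h' (cls [Inr y]) = g y)"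
    have h'_hom: "h' \<in> hom P K" and h'_ext: "h' \<in> extensional (carrier P)"
      using h' by simp_all
    have h'_letter: "h' (cls [s]) = case_sum f g s" if "[s] \<in> W" for s
      using h' that by (cases s) simp_all
    have h'_cls: "h' (cls w) = ev w" if "w \<in> W" for w
      using that
    proof (induction w)
      case Nil
      show ?case
        using hom_one[OF h'_hom group_P K] by (simp add: ev_def one_P)
    next
      case (Cons s w)
      then have w: "[s] \<in> W" "w \<in> W" by (simp_all add: amalg_words_def)
      then have "cls (s # w) = cls [s] \<otimes>\<^bsub>P\<^esub> cls w"
        using mult_cls[of "[s]" w] by simp
      then have "h' (cls (s # w)) = h' (cls [s]) \<otimes>\<^bsub>K\<^esub> h' (cls w)"
        using hom_mult[OF h'_hom] w by (simp add: carrier_P)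
      then show ?case
        using Cons.IH h'_letter w by (simp add: ev_def)
    qed
    show "h' = h"
    proof (rule extensionalityI[OF h'_ext])
      show "h \<in> extensional (carrier P)" by (simp add: h_def)
      show "h' p = h p" if "p \<in> carrier P" for p
        using that h_cls h'_cls unfolding carrier_P by fastforce
    qed
  qed
qed

end

end

theory Submission
  imports Defs
begin

text \<open>
  A group is CSA if and only if commutation is transitive on its nontrivial elements and an element
  \<open>a\<close> that commutes with its conjugate by \<open>x\<close> commutes with \<open>x\<close>
  (\<open>CSA_groupI\<close> and the lemmas before it).

  If neither \<open>A\<close> nor \<open>B\<close> is maximal abelian, then some \<open>x \<in> G - A\<close> and \<open>y \<in> H - B\<close>
  both centralize a nontrivial element of the amalgamated subgroup. In the amalgam they do not commute,
  because their commutator is a reduced word of length four. So commutation is not transitive.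

  Conversely, a maximal abelian subgroup of a CSA group is malnormal, so the amalgamated subgroup
  \<open>C\<close> is malnormal in one of the factors, say \<open>U\<close>. This drives the whole argument.
  The picture behind it is the action on the Bass-Serre tree. It enters through the length function of
  reduced words, which satisfies the four point condition of a tree metric (\<open>four_point\<close>). An element
  is of one of two kinds (\<open>elliptic_or_cyclically_reduced\<close>).

  Elliptic elements are conjugate into a factor. Malnormality of \<open>C\<close> in \<open>U\<close> makes the other factor
  \<open>V\<close> malnormal in the whole group (\<open>malnormal_V\<close>), while an element of \<open>U\<close> that is not conjugate
  into \<open>V\<close> stays in \<open>U\<close> only under conjugation by \<open>U\<close> (\<open>conjugate_into_C\<close>). So everything
  that concerns the centralizer of an elliptic element happens inside one factor
  (\<open>elliptic_element\<close>).

  Hyperbolic elements are conjugate to a word \<open>g\<close> whose powers are reduced. The centralizer of \<open>g\<close> acts on the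
  axis of \<open>g\<close> by translations, and the signed translation distance is a homomorphism to the integers. It
  is obtained from the limit of \<open>len (z \<otimes> g [^] n) - n * len g\<close> (\<open>translation_mult\<close>), and its absolute
  value is the length (\<open>len_eq_translation\<close>). Its kernel therefore consists of elliptic elements
  centralized by \<open>g\<close>, and is trivial by malnormality of \<open>V\<close>. So the centralizer is abelian, and a conjugate
  of \<open>g\<close> in it can only be \<open>g\<close> or its inverse. The inverse is excluded by the absence of elements of
  order two, which also passes to the amalgam (\<open>hyperbolic_separated\<close>).

  The length function itself comes from an action of the words on formal normal forms
  (\<open>run_amalg_eq\<close>, \<open>decomposition\<close>).
\<close>

section \<open>CSA groups in terms of single elements\<close>

definition commutative_transitive :: "('a, 'm) monoid_scheme \<Rightarrow> 'a set \<Rightarrow> bool" where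
  "commutative_transitive G U \<longleftrightarrow>
     (\<forall>a\<in>U. a \<noteq> \<one>\<^bsub>G\<^esub> \<longrightarrow> (\<forall>x\<in>U. \<forall>y\<in>U. x \<otimes>\<^bsub>G\<^esub> a = a \<otimes>\<^bsub>G\<^esub> x \<longrightarrow>
        y \<otimes>\<^bsub>G\<^esub> a = a \<otimes>\<^bsub>G\<^esub> y \<longrightarrow> x \<otimes>\<^bsub>G\<^esub> y = y \<otimes>\<^bsub>G\<^esub> x))"

text \<open>
  Malnormality of the maximal abelian subgroups, seen from one element: a maximal abelian subgroup
  that contains a nontrivial \<open>a\<close> and its conjugate by \<open>x\<close> must contain \<open>x\<close> as well.
\<close>

definition conjugation_separated :: "('a, 'm) monoid_scheme \<Rightarrow> 'a set \<Rightarrow> bool" where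
  "conjugation_separated G U \<longleftrightarrow>
     (\<forall>a\<in>U. \<forall>x\<in>U. a \<otimes>\<^bsub>G\<^esub> (x \<otimes>\<^bsub>G\<^esub> a \<otimes>\<^bsub>G\<^esub> inv\<^bsub>G\<^esub> x) = (x \<otimes>\<^bsub>G\<^esub> a \<otimes>\<^bsub>G\<^esub> inv\<^bsub>G\<^esub> x) \<otimes>\<^bsub>G\<^esub> a \<longrightarrow>
        x \<otimes>\<^bsub>G\<^esub> a = a \<otimes>\<^bsub>G\<^esub> x)"

definition involution_free :: "('a, 'm) monoid_scheme \<Rightarrow> 'a set \<Rightarrow> bool" where
  "involution_free G U \<longleftrightarrow> (\<forall>x\<in>U. x \<otimes>\<^bsub>G\<^esub> x = \<one>\<^bsub>G\<^esub> \<longrightarrow> x = \<one>\<^bsub>G\<^esub>)"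

definition commuting_set :: "('a, 'm) monoid_scheme \<Rightarrow> 'a set \<Rightarrow> bool" where
  "commuting_set G S \<longleftrightarrow> S \<subseteq> carrier G \<and> (\<forall>x\<in>S. \<forall>y\<in>S. x \<otimes>\<^bsub>G\<^esub> y = y \<otimes>\<^bsub>G\<^esub> x)"

lemma comm_subgroup_commuting:
  assumes "comm_subgroup K G"
  shows "commuting_set G K"
  using assms subgroup.subset[of K G] comm_monoid.m_comm[of "G\<lparr>carrier := K\<rparr>"]
  by (fastforce simp: comm_subgroup_def commuting_set_def comm_group_def)

lemma (in group) comm_subgroupI:
  assumes "subgroup K G" "commuting_set G K"
  shows "comm_subgroup K G"
  unfolding comm_subgroup_def
proof
  show "comm_group (G\<lparr>carrier := K\<rparr>)"
    by (rule group.group_comm_groupI[OF subgroup_imp_group[OF assms(1)]])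
      (use assms(2) in \<open>simp add: commuting_set_def\<close>)
qed fact

lemma (in group) commute_inv:
  assumes "x \<in> carrier G" "y \<in> carrier G" "x \<otimes> y = y \<otimes> x"
  shows "inv x \<otimes> y = y \<otimes> inv x"
proof -
  have "y \<otimes> inv x = inv x \<otimes> (x \<otimes> y) \<otimes> inv x" using assms(1,2) by (simp add: m_assoc[symmetric])
  also have "\<dots> = inv x \<otimes> y"
    unfolding assms(3) using assms(1,2) by (simp add: m_assoc)
  finally show ?thesis by simp
qed

lemma (in group) commute_mult:
  assumes "x \<in> carrier G" "y \<in> carrier G" "z \<in> carrier G" "x \<otimes> z = z \<otimes> x" "y \<otimes> z = z \<otimes> y"
  shows "x \<otimes> y \<otimes> z = z \<otimes> (x \<otimes> y)"
  using assms by (metis m_assoc)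

text \<open>
  Zorn's lemma is applied to sets of pairwise commuting elements rather than to subgroups: such sets
  are closed under unions of chains for trivial reasons, and a maximal one is a subgroup because it
  contains every element that commutes with all of it.
\<close>

lemma (in group) commuting_subset_maximal_abelian:
  assumes "commuting_set G S"
  shows "\<exists>M. S \<subseteq> M \<and> maximal_abelian M G"
proof -
  let ?F = "{T. S \<subseteq> T \<and> commuting_set G T}"
  have "\<exists>M\<in>?F. \<forall>T\<in>?F. M \<subseteq> T \<longrightarrow> T = M"
  proof (rule subset_Zorn_nonempty)
    show "?F \<noteq> {}" using assms by blast
    fix \<C> assume "\<C> \<noteq> {}" and chain: "subset.chain ?F \<C>"
    then have sub: "\<C> \<subseteq> ?F" by (simp add: subset.chain_def)
    have "x \<otimes> y = y \<otimes> x" if xy: "x \<in> \<Union>\<C>" "y \<in> \<Union>\<C>" for x y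
    proof -
      obtain T U where TU: "T \<in> \<C>" "U \<in> \<C>" "x \<in> T" "y \<in> U" using xy by blast
      then have "T \<subseteq> U \<or> U \<subseteq> T" using chain by (auto simp: subset_chain_def)
      then obtain V where "V \<in> \<C>" "x \<in> V" "y \<in> V" using TU by blast
      then show ?thesis using sub by (auto simp: commuting_set_def)
    qed
    then show "\<Union>\<C> \<in> ?F"
      using sub \<open>\<C> \<noteq> {}\<close> by (fastforce simp: commuting_set_def)
  qed
  then obtain M where "M \<in> ?F" and max0: "\<forall>T\<in>?F. M \<subseteq> T \<longrightarrow> T = M" ..
  then have M: "S \<subseteq> M" "commuting_set G M" by simp_all
  have max: "T = M" if "commuting_set G T" "M \<subseteq> T" for T
    using bspec[OF max0, of T] that M(1) by simp
  have comm: "x \<otimes> y = y \<otimes> x" if "x \<in> M" "y \<in> M" for x y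
    using M(2) that by (auto simp: commuting_set_def)
  \<comment> \<open>A maximal commuting set contains everything that commutes with it; this makes it a subgroup.\<close>
  have absorb: "x \<in> M" if "x \<in> carrier G" "\<And>y. y \<in> M \<Longrightarrow> x \<otimes> y = y \<otimes> x" for x
  proof -
    have "commuting_set G (insert x M)"
      using M(2) that by (auto simp: commuting_set_def)
    then show ?thesis using max[of "insert x M"] by blast
  qed
  have MC: "x \<in> carrier G" if "x \<in> M" for x
    using M(2) that by (auto simp: commuting_set_def)
  have "subgroup M G"
  proof
    show "M \<subseteq> carrier G" using MC by blast
    show "\<one> \<in> M" by (rule absorb) (simp_all add: MC)
    show "x \<otimes> y \<in> M" if "x \<in> M" "y \<in> M" for x y
      using that MC comm by (intro absorb commute_mult) auto
    show "inv x \<in> M" if "x \<in> M" for x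
      using that MC comm by (intro absorb commute_inv) auto
  qed
  then have "comm_subgroup M G" using M(2) by (rule comm_subgroupI)
  then have "maximal_abelian M G"
    using max comm_subgroup_commuting unfolding maximal_abelian_def by blast
  with M(1) show ?thesis by blast
qed

lemma (in group) mem_conjugate_coset_iff:
  assumes "K \<subseteq> carrier G" "x \<in> carrier G" "g \<in> carrier G"
  shows "g \<in> inv x <# (K #> x) \<longleftrightarrow> x \<otimes> g \<otimes> inv x \<in> K"
proof
  assume "g \<in> inv x <# (K #> x)"
  then obtain k where k: "k \<in> K" "g = inv x \<otimes> (k \<otimes> x)"
    by (auto simp: l_coset_def r_coset_def)
  then have "x \<otimes> g \<otimes> inv x = k"
    using assms by (simp add: m_assoc subsetD) (simp add: m_assoc[symmetric] subsetD)
  with k show "x \<otimes> g \<otimes> inv x \<in> K" by simp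
next
  assume *: "x \<otimes> g \<otimes> inv x \<in> K"
  have "g = inv x \<otimes> (x \<otimes> g \<otimes> inv x \<otimes> x)"
    using assms by (simp add: m_assoc) (simp add: m_assoc[symmetric])
  with * show "g \<in> inv x <# (K #> x)"
    by (auto simp: l_coset_def r_coset_def)
qed

lemma (in group) malnormal_iff:
  "malnormal K G \<longleftrightarrow> subgroup K G \<and>
    (\<forall>x\<in>carrier G - K. \<forall>g\<in>K. x \<otimes> g \<otimes> inv x \<in> K \<longrightarrow> g = \<one>)"
proof (cases "subgroup K G")
  case True
  then have K: "K \<subseteq> carrier G" "\<one> \<in> K" by (simp_all add: subgroup.subset subgroup.one_closed)
  have "K \<inter> (inv x <# (K #> x)) = {\<one>} \<longleftrightarrow> (\<forall>g\<in>K. x \<otimes> g \<otimes> inv x \<in> K \<longrightarrow> g = \<one>)"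
    if "x \<in> carrier G" for x
  proof -
    have "\<one> \<in> inv x <# (K #> x)"
      using mem_conjugate_coset_iff[OF K(1) that one_closed] that K(2) by simp
    then show ?thesis
      using mem_conjugate_coset_iff[OF K(1) that] K by blast
  qed
  then show ?thesis using True by (simp add: malnormal_def)
qed (simp add: malnormal_def)

text \<open>
  If \<open>y\<close> commutes with \<open>a\<close>, then \<open>a\<close> lies in a maximal abelian subgroup \<open>M\<close> containing \<open>x\<close> and is fixed
  by conjugation with \<open>y\<close>, so malnormality of \<open>M\<close> puts \<open>y\<close> into \<open>M\<close>.
\<close>

lemma (in group) CSA_group_commutative_transitive:
  assumes "CSA_group G"
  shows "commutative_transitive G (carrier G)"
  unfolding commutative_transitive_def
proof (intro ballI impI)
  fix a x y assume a: "a \<in> carrier G" "a \<noteq> \<one>" and x: "x \<in> carrier G" "x \<otimes> a = a \<otimes> x"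
    and y: "y \<in> carrier G" "y \<otimes> a = a \<otimes> y"
  have "commuting_set G {a, x}" using a x by (simp add: commuting_set_def)
  then obtain M where M: "{a, x} \<subseteq> M" "maximal_abelian M G"
    using commuting_subset_maximal_abelian by blast
  then have mal: "malnormal M G" using assms by (simp add: CSA_group_def)
  have "y \<otimes> a \<otimes> inv y = a" using a y by (simp add: m_assoc)
  then have "y \<in> M" using M(1) mal a(2) y(1) unfolding malnormal_iff by (metis Diff_iff insert_subset)
  then show "x \<otimes> y = y \<otimes> x"
    using M comm_subgroup_commuting[of M G] by (simp add: maximal_abelian_def commuting_set_def)
qed

lemma (in group) CSA_group_conjugation_separated:
  assumes "CSA_group G"
  shows "conjugation_separated G (carrier G)"
  unfolding conjugation_separated_def
proof (intro ballI impI)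
  fix a x assume a: "a \<in> carrier G" and x: "x \<in> carrier G"
    and c: "a \<otimes> (x \<otimes> a \<otimes> inv x) = x \<otimes> a \<otimes> inv x \<otimes> a"
  let ?b = "x \<otimes> a \<otimes> inv x"
  show "x \<otimes> a = a \<otimes> x"
  proof (cases "a = \<one>")
    case False
    have "commuting_set G {a, ?b}" using a x c by (simp add: commuting_set_def)
    then obtain M where M: "{a, ?b} \<subseteq> M" "maximal_abelian M G"
      using commuting_subset_maximal_abelian by blast
    then have "malnormal M G" using assms by (simp add: CSA_group_def)
    then have "x \<in> M"
      using M(1) False x unfolding malnormal_iff by (metis Diff_iff insert_subset)
    then show ?thesis
      using M comm_subgroup_commuting[of M G] by (simp add: maximal_abelian_def commuting_set_def)
  qed (use x in simp)
qed

text \<open>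
  A nontrivial \<open>g\<close> in a maximal abelian \<open>K\<close> whose conjugate by \<open>x\<close> is again in \<open>K\<close> commutes with that
  conjugate, hence with \<open>x\<close>; by transitivity \<open>x\<close> commutes with all of \<open>K\<close>, and maximality gives
  \<open>x \<in> K\<close>.
\<close>

lemma (in group) CSA_groupI:
  assumes ct: "commutative_transitive G (carrier G)"
    and cs: "conjugation_separated G (carrier G)"
  shows "CSA_group G"
  unfolding CSA_group_def
proof (intro conjI allI impI)
  fix K assume K: "maximal_abelian K G"
  then have sub: "subgroup K G" and com: "commuting_set G K"
    using comm_subgroup_commuting by (auto simp: maximal_abelian_def comm_subgroup_def)
  have "x \<in> K" if g: "g \<in> K" "g \<noteq> \<one>" "x \<otimes> g \<otimes> inv x \<in> K" and x: "x \<in> carrier G" for x g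
  proof -
    have gc: "g \<in> carrier G" and one: "\<And>y. y \<in> K \<Longrightarrow> y \<in> carrier G \<and> y \<otimes> g = g \<otimes> y"
      using com g by (auto simp: commuting_set_def)
    have "g \<otimes> (x \<otimes> g \<otimes> inv x) = x \<otimes> g \<otimes> inv x \<otimes> g"
      using com g(1,3) by (simp add: commuting_set_def)
    then have xg: "x \<otimes> g = g \<otimes> x" using cs gc x unfolding conjugation_separated_def by blast
    have "x \<otimes> y = y \<otimes> x" if "y \<in> K" for y
      using ct gc g(2) x xg one[OF that] unfolding commutative_transitive_def by metis
    then have "commuting_set G (insert x K)"
      using com x by (auto simp: commuting_set_def)
    then obtain M where "insert x K \<subseteq> M" "maximal_abelian M G"
      using commuting_subset_maximal_abelian by blast
    then show ?thesis using K unfolding maximal_abelian_def by blast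
  qed
  then show "malnormal K G" using sub by (auto simp: malnormal_iff)
qed (rule is_group)

lemma (in group) no_order_2_iff:
  "\<not> (\<exists>x\<in>carrier G. ord x = 2) \<longleftrightarrow> involution_free G (carrier G)"
proof -
  have "ord x = 2 \<longleftrightarrow> x \<otimes> x = \<one> \<and> x \<noteq> \<one>" if x: "x \<in> carrier G" for x
  proof
    assume "ord x = 2"
    then show "x \<otimes> x = \<one> \<and> x \<noteq> \<one>"
      using x pow_ord_eq_1[OF x] ord_eq_1[OF x] by (simp add: numeral_2_eq_2)
  next
    assume *: "x \<otimes> x = \<one> \<and> x \<noteq> \<one>"
    then have "ord x dvd 2" using x pow_eq_id[OF x, of 2] by (simp add: numeral_2_eq_2)
    then have "ord x = 1 \<or> ord x = 2"
      by (metis prime_nat_iff two_is_prime_nat)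
    then show "ord x = 2" using * ord_eq_1[OF x] by simp
  qed
  then show ?thesis by (auto simp: involution_free_def)
qed

text \<open>
  This form passes to subgroups and along injective homomorphisms and can be checked one conjugacy
  class at a time, neither of which is apparent for maximal abelian subgroups.
\<close>

theorem (in group) CSA_star_group_iff:
  "CSA_star_group G \<longleftrightarrow> commutative_transitive G (carrier G) \<and>
     conjugation_separated G (carrier G) \<and> involution_free G (carrier G)"
  unfolding CSA_star_group_def no_order_2_iff
  using CSA_groupI CSA_group_commutative_transitive CSA_group_conjugation_separated by blast

section \<open>Alternating words and the length function of an amalgam\<close>

definition (in monoid) word_prod :: "'a list \<Rightarrow> 'a" where
  "word_prod w = foldr (\<otimes>) w \<one>"

lemma (in monoid) word_prod_Nil [simp]: "word_prod [] = \<one>"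
  and word_prod_Cons [simp]: "word_prod (s # w) = s \<otimes> word_prod w"
  by (simp_all add: word_prod_def)

lemma (in monoid) word_prod_closed [simp]: "set w \<subseteq> carrier G \<Longrightarrow> word_prod w \<in> carrier G"
  by (induction w) simp_all

lemma (in monoid) word_prod_append:
  "set u \<subseteq> carrier G \<Longrightarrow> set v \<subseteq> carrier G \<Longrightarrow> word_prod (u @ v) = word_prod u \<otimes> word_prod v"
  by (induction u) (simp_all add: m_assoc)

abbreviation (in group) inv_word :: "'a list \<Rightarrow> 'a list" where
  "inv_word w \<equiv> rev (map (\<lambda>s. inv s) w)"

lemma (in group) inv_word_carrier [simp]: "set w \<subseteq> carrier G \<Longrightarrow> set (inv_word w) \<subseteq> carrier G"
  by auto

lemma (in group) word_prod_inv_word: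
  "set w \<subseteq> carrier G \<Longrightarrow> word_prod (inv_word w) = inv (word_prod w)"
proof (induction w)
  case (Cons s w)
  moreover have "set (inv_word w) \<subseteq> carrier G" using Cons.prems by auto
  ultimately show ?case by (simp add: word_prod_append inv_mult_group)
qed simp

text \<open>
  Because of the choice operator, the representative depends on the coset \<open>sD\<close> only, not on \<open>s\<close>.
\<close>

definition (in group) left_rep :: "'a set \<Rightarrow> 'a \<Rightarrow> 'a" where
  "left_rep D s = (SOME t. \<exists>d\<in>D. t = s \<otimes> d)"

lemma (in group) left_rep_eq:
  assumes "subgroup D G" "s \<in> carrier G"
  shows "\<exists>d\<in>D. left_rep D s = s \<otimes> d"
  unfolding left_rep_def
  by (rule someI_ex, rule exI[of _ "s \<otimes> \<one>"], rule bexI[of _ \<one>])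
    (simp_all add: assms subgroup.one_closed)

lemma (in group) left_rep_mult:
  assumes D: "subgroup D G" and s: "s \<in> carrier G" and c: "c \<in> D"
  shows "left_rep D (s \<otimes> c) = left_rep D s"
proof -
  note mem = subgroup.mem_carrier[OF D]
  have "(\<exists>d\<in>D. t = s \<otimes> c \<otimes> d) \<longleftrightarrow> (\<exists>d\<in>D. t = s \<otimes> d)" for t
  proof
    assume "\<exists>d\<in>D. t = s \<otimes> c \<otimes> d"
    then obtain d where "d \<in> D" "t = s \<otimes> (c \<otimes> d)" using s c mem by (auto simp: m_assoc)
    then show "\<exists>d\<in>D. t = s \<otimes> d" using subgroup.m_closed[OF D c] by blast
  next
    assume "\<exists>d\<in>D. t = s \<otimes> d"
    then obtain d where d: "d \<in> D" "t = s \<otimes> d" by blast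
    then have "t = s \<otimes> c \<otimes> (inv c \<otimes> d)"
      using s c mem by (simp add: m_assoc) (simp add: m_assoc[symmetric])
    then show "\<exists>d\<in>D. t = s \<otimes> c \<otimes> d"
      using subgroup.m_closed[OF D subgroup.m_inv_closed[OF D c] d(1)] by blast
  qed
  then show ?thesis by (simp add: left_rep_def)
qed

text \<open>
  The letters avoid the intersection of \<open>U\<close> and \<open>V\<close>, so membership in \<open>U\<close> tells which of the two factors a
  letter comes from, and the definition is symmetric in \<open>U\<close> and \<open>V\<close>.
\<close>

definition alternating :: "'a set \<Rightarrow> 'a set \<Rightarrow> 'a list \<Rightarrow> bool" where
  "alternating U V w \<longleftrightarrow> set w \<subseteq> (U - V) \<union> (V - U) \<and> successively (\<lambda>s t. (s \<in> U) \<noteq> (t \<in> U)) w"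

lemma alternating_Nil [simp]: "alternating U V []"
  by (simp add: alternating_def)

lemma alternating_Cons:
  "alternating U V (s # w) \<longleftrightarrow>
     s \<in> (U - V) \<union> (V - U) \<and> alternating U V w \<and> (w = [] \<or> (s \<in> U) \<noteq> (hd w \<in> U))"
  by (auto simp: alternating_def successively_Cons)

lemma alternating_append:
  "alternating U V (u @ v) \<longleftrightarrow> alternating U V u \<and> alternating U V v \<and>
     (u = [] \<or> v = [] \<or> (last u \<in> U) \<noteq> (hd v \<in> U))"
  by (auto simp: alternating_def successively_append_iff)

lemma alternating_swap: "alternating V U w \<longleftrightarrow> alternating U V w"
proof (induction w)
  case (Cons s w)
  then show ?case by (cases w) (auto simp: alternating_Cons)
qed simp

text \<open>
  A group that is, internally, the amalgam of its subgroups \<open>U\<close> and \<open>V\<close> over their intersection: the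
  normal form theorem is recorded as the existence of a function \<open>len\<close> that reads off the number of
  letters of an alternating word. In terms of the Bass-Serre tree, whose edges are the left cosets
  of the intersection, \<open>len g\<close> is the distance between the midpoints of the base edge and of its image
  under \<open>g\<close>. The description is symmetric, so one of the two factors can be singled out without loss of
  generality.
\<close>

locale amalgam_decomposition = group P for P :: "('a, 'm) monoid_scheme" (structure) +
  fixes U V :: "'a set" and len :: "'a \<Rightarrow> nat"
  assumes subgroup_U: "subgroup U P" and subgroup_V: "subgroup V P"
    and generated: "carrier P \<subseteq> generate P (U \<union> V)"
    and len_word: "alternating U V w \<Longrightarrow> c \<in> U \<inter> V \<Longrightarrow> len (word_prod w \<otimes> c) = length w"
begin

abbreviation "C \<equiv> U \<inter> V"

abbreviation "alt \<equiv> alternating U V"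

lemma swap: "amalgam_decomposition P V U len"
proof (intro amalgam_decomposition.intro amalgam_decomposition_axioms.intro is_group)
  show "subgroup V P" "subgroup U P" by (fact subgroup_V, fact subgroup_U)
  show "carrier P \<subseteq> generate P (V \<union> U)" using generated by (simp add: Un_commute)
  show "len (word_prod w \<otimes> c) = length w" if "alternating V U w" "c \<in> V \<inter> U" for w c
    using that len_word by (simp add: alternating_swap Int_commute)
qed

lemma U_carrier [simp]: "x \<in> U \<Longrightarrow> x \<in> carrier P"
  and V_carrier [simp]: "x \<in> V \<Longrightarrow> x \<in> carrier P"
  using subgroup.subset[OF subgroup_U] subgroup.subset[OF subgroup_V] by auto

lemma U_closed [simp]: "\<one> \<in> U" "x \<in> U \<Longrightarrow> inv x \<in> U" "x \<in> U \<Longrightarrow> y \<in> U \<Longrightarrow> x \<otimes> y \<in> U"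
  using subgroup_U by (simp_all add: subgroup.one_closed subgroup.m_inv_closed subgroup.m_closed)

lemma V_closed [simp]: "\<one> \<in> V" "x \<in> V \<Longrightarrow> inv x \<in> V" "x \<in> V \<Longrightarrow> y \<in> V \<Longrightarrow> x \<otimes> y \<in> V"
  using subgroup_V by (simp_all add: subgroup.one_closed subgroup.m_inv_closed subgroup.m_closed)

lemma U_cancel_left: "x \<in> U \<Longrightarrow> y \<in> carrier P \<Longrightarrow> x \<otimes> y \<in> U \<longleftrightarrow> y \<in> U"
  and U_cancel_right: "x \<in> U \<Longrightarrow> y \<in> carrier P \<Longrightarrow> y \<otimes> x \<in> U \<longleftrightarrow> y \<in> U"
proof -
  assume x: "x \<in> U" and y: "y \<in> carrier P"
  have "y \<in> U" if "x \<otimes> y \<in> U"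
    using U_closed(3)[OF U_closed(2)[OF x] that] x y by (simp add: m_assoc[symmetric])
  then show "x \<otimes> y \<in> U \<longleftrightarrow> y \<in> U" using x by auto
  have "y \<in> U" if "y \<otimes> x \<in> U"
    using U_closed(3)[OF that U_closed(2)[OF x]] x y by (simp add: m_assoc)
  then show "y \<otimes> x \<in> U \<longleftrightarrow> y \<in> U" using x by auto
qed

lemmas V_cancel_left = amalgam_decomposition.U_cancel_left[OF swap]
lemmas V_cancel_right = amalgam_decomposition.U_cancel_right[OF swap]

lemma inv_mem_U: "x \<in> carrier P \<Longrightarrow> inv x \<in> U \<longleftrightarrow> x \<in> U"
  and inv_mem_V: "x \<in> carrier P \<Longrightarrow> inv x \<in> V \<longleftrightarrow> x \<in> V"
  by (metis U_closed(2) inv_inv, metis V_closed(2) inv_inv)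

lemma alt_carrier [simp]: "alt w \<Longrightarrow> set w \<subseteq> carrier P"
  by (auto simp: alternating_def)

lemma alt_inv_word [simp]: "alt w \<Longrightarrow> alt (inv_word w)"
proof (induction w)
  case (Cons s w)
  then have "s \<in> carrier P" "w \<noteq> [] \<Longrightarrow> hd w \<in> carrier P"
    using alt_carrier[OF Cons.prems] by (auto simp: subset_iff)
  moreover have "w \<noteq> [] \<Longrightarrow> last (inv_word w) = inv (hd w)"
    by (simp add: last_rev hd_map)
  ultimately show ?case using Cons
    by (auto simp: alternating_Cons alternating_append inv_mem_U inv_mem_V)
qed simp

lemma left_absorb:
  assumes "c \<in> C" "alt w"
  shows "\<exists>w' c'. alt w' \<and> c' \<in> C \<and> c \<otimes> word_prod w = word_prod w' \<otimes> c' \<and> length w' = length w"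
proof (cases w)
  case Nil
  then show ?thesis using assms by (intro exI[of _ "[]"] exI[of _ c]) simp
next
  case (Cons s v)
  then have s: "s \<in> carrier P" "set v \<subseteq> carrier P" using alt_carrier[OF assms(2)] by auto
  have "alt ((c \<otimes> s) # v)"
    using assms s unfolding Cons by (auto simp: alternating_Cons U_cancel_left V_cancel_left)
  then show ?thesis
    using assms s Cons by (intro exI[of _ "(c \<otimes> s) # v"] exI[of _ \<one>]) (simp add: m_assoc)
qed

lemma letter_mult_normal_form:
  assumes s: "s \<in> U \<union> V" and w: "alt w"
  shows "\<exists>w' c'. alt w' \<and> c' \<in> C \<and> s \<otimes> word_prod w = word_prod w' \<otimes> c'"
proof (cases "s \<in> C")
  case True
  then show ?thesis using left_absorb w by blast
next
  case False
  show ?thesis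
  proof (cases "w = [] \<or> (s \<in> U) \<noteq> (hd w \<in> U)")
    case True
    then have "alt (s # w)" using False s w by (auto simp: alternating_Cons)
    then show ?thesis
      using s w by (intro exI[of _ "s # w"] exI[of _ \<one>]) auto
  next
    case same: False
    then obtain t v where wt: "w = t # v" by (cases w) auto
    then have t: "t \<in> (U - V) \<union> (V - U)" "alt v" using w by (auto simp: alternating_Cons)
    have st: "s \<otimes> t \<in> U \<union> V" "(s \<otimes> t \<in> U) = (t \<in> U) \<or> s \<otimes> t \<in> C" "s \<in> carrier P" "t \<in> carrier P"
      using s t same False wt by (auto simp: V_cancel_left U_cancel_left)
    have e: "s \<otimes> word_prod w = (s \<otimes> t) \<otimes> word_prod v"
      using t st by (simp add: wt m_assoc)
    show ?thesis
    proof (cases "s \<otimes> t \<in> C")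
      case True
      then show ?thesis unfolding e using left_absorb t by blast
    next
      case False
      then have "alt ((s \<otimes> t) # v)" using st w t unfolding wt by (auto simp: alternating_Cons)
      then show ?thesis
        unfolding e using st t by (intro exI[of _ "(s \<otimes> t) # v"] exI[of _ \<one>]) auto
    qed
  qed
qed

lemma normal_form:
  assumes "g \<in> carrier P"
  shows "\<exists>w c. alt w \<and> c \<in> C \<and> g = word_prod w \<otimes> c"
proof -
  let ?N = "{g. \<exists>w c. alt w \<and> c \<in> C \<and> g = word_prod w \<otimes> c}"
  have N: "?N \<subseteq> carrier P" by auto
  have letter: "s \<otimes> h \<in> ?N" if s: "s \<in> U \<union> V" and "h \<in> ?N" for s h
  proof -
    from that(2) obtain w c where h: "alt w" "c \<in> C" "h = word_prod w \<otimes> c" by blast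
    obtain w' c' where "alt w'" "c' \<in> C" "s \<otimes> word_prod w = word_prod w' \<otimes> c'"
      using letter_mult_normal_form[OF s h(1)] by blast
    moreover from this have "s \<otimes> h = word_prod w' \<otimes> (c' \<otimes> c)"
      using h s by (auto simp: m_assoc[symmetric])
    ultimately show ?thesis using h(2) by (metis (mono_tags, lifting) CollectI IntD1 IntD2 IntI U_closed(3) V_closed(3))
  qed
  have "\<forall>h\<in>?N. g \<otimes> h \<in> ?N" if "g \<in> generate P (U \<union> V)" for g
    using that
  proof (induction rule: generate.induct)
    case one
    show ?case
    proof
      fix h assume "h \<in> ?N"
      moreover from this have "\<one> \<otimes> h = h" using N by (intro l_one) blast
      ultimately show "\<one> \<otimes> h \<in> ?N" by (simp only:)
    qed
  next
    case (incl s)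
    then show ?case using letter by blast
  next
    case (inv s)
    then have "inv s \<in> U \<union> V" by auto
    then show ?case using letter by blast
  next
    case (eng g1 g2)
    have "U \<union> V \<subseteq> carrier P" by auto
    then have c: "g1 \<in> carrier P" "g2 \<in> carrier P"
      using eng.hyps generate_in_carrier by blast+
    show ?case
    proof
      fix h assume h: "h \<in> ?N"
      then have "g1 \<otimes> (g2 \<otimes> h) \<in> ?N" using eng.IH by blast
      then show "g1 \<otimes> g2 \<otimes> h \<in> ?N" using c h N by (simp add: m_assoc subset_iff)
    qed
  qed
  moreover have "\<one> \<in> ?N" by (rule CollectI, rule exI[of _ "[]"], rule exI[of _ \<one>]) simp
  moreover have "g \<in> generate P (U \<union> V)" using assms generated by blast
  ultimately have "g \<otimes> \<one> \<in> ?N" by blast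
  then show ?thesis using assms by simp
qed

lemma len_word_prod: "alt w \<Longrightarrow> len (word_prod w) = length w"
  using len_word[of w \<one>] by simp

lemma len_mult_C_right: "g \<in> carrier P \<Longrightarrow> c \<in> C \<Longrightarrow> len (g \<otimes> c) = len g"
proof -
  assume "g \<in> carrier P" and c: "c \<in> C"
  then obtain w d where g: "alt w" "d \<in> C" "g = word_prod w \<otimes> d" using normal_form by blast
  then have "g \<otimes> c = word_prod w \<otimes> (d \<otimes> c)" using c by (auto simp: m_assoc)
  then show ?thesis using len_word[OF g(1)] g c by simp
qed

lemma len_inv: "g \<in> carrier P \<Longrightarrow> len (inv g) = len g"
proof -
  assume "g \<in> carrier P"
  then obtain w d where g: "alt w" "d \<in> C" "g = word_prod w \<otimes> d" using normal_form by blast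
  then have "inv g = inv d \<otimes> word_prod (inv_word w)"
    by (auto simp: inv_mult_group word_prod_inv_word)
  moreover obtain w' c' where "alt w'" "c' \<in> C" "length w' = length w"
      "inv d \<otimes> word_prod (inv_word w) = word_prod w' \<otimes> c'"
    using left_absorb[of "inv d" "inv_word w"] g by auto
  ultimately show ?thesis using g len_word by simp
qed

lemma len_mult_C_left: "g \<in> carrier P \<Longrightarrow> c \<in> C \<Longrightarrow> len (c \<otimes> g) = len g"
  using len_mult_C_right[of "inv g" "inv c"] len_inv[of "c \<otimes> g"] len_inv[of g]
  by (simp add: inv_mult_group)

lemma len_eq_0_iff: "g \<in> carrier P \<Longrightarrow> len g = 0 \<longleftrightarrow> g \<in> C"
proof
  have "len d = 0" if "d \<in> C" for d using len_word[of "[]" d] that by simp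
  then show "g \<in> C \<Longrightarrow> len g = 0" .
  assume "g \<in> carrier P" and 0: "len g = 0"
  then obtain w d where g: "alt w" "d \<in> C" "g = word_prod w \<otimes> d" using normal_form by blast
  with 0 have "w = []" using len_word[OF g(1,2)] by simp
  with g show "g \<in> C" by simp
qed

lemma len_le_1: "g \<in> U \<union> V \<Longrightarrow> len g \<le> 1"
proof (cases "g \<in> C")
  case True
  then show ?thesis using len_eq_0_iff[of g] by simp
next
  case False
  assume "g \<in> U \<union> V"
  with False have "alt [g]" by (auto simp: alternating_Cons)
  then show ?thesis using len_word_prod[of "[g]"] \<open>g \<in> U \<union> V\<close> by auto
qed

text \<open>
  No cancellation happens around \<open>b\<close>, so the conjugate is again spelled by an alternating word. This
  keeps conjugates of elements of the factors from falling back into a factor.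
\<close>

lemma len_conjugate_letter:
  assumes "alt (w @ [b])"
  shows "len (word_prod w \<otimes> b \<otimes> inv (word_prod w)) = 2 * length w + 1"
proof -
  have w: "alt w" "set w \<subseteq> carrier P" "b \<in> carrier P"
    using assms alt_carrier[OF assms] by (auto simp: alternating_append)
  have iw: "set (inv_word w) \<subseteq> carrier P" using w(2) by (rule inv_word_carrier)
  have "last w \<in> carrier P" if "w \<noteq> []" using that w(2) last_in_set by blast
  then have "w = [] \<or> (b \<in> U) \<noteq> (hd (inv_word w) \<in> U)"
    using assms by (simp add: alternating_append hd_rev last_map inv_mem_U disj_imp)
  then have "alt ((w @ [b]) @ inv_word w)"
    unfolding alternating_append[of U V "w @ [b]"] using assms alt_inv_word[OF w(1)] by simp
  moreover have "word_prod ((w @ [b]) @ inv_word w) = word_prod w \<otimes> b \<otimes> inv (word_prod w)"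
    using w(2,3) iw by (simp add: word_prod_append word_prod_inv_word m_assoc)
  ultimately show ?thesis using len_word_prod by fastforce
qed

abbreviation coset_rep :: "'a \<Rightarrow> 'a" where
  "coset_rep \<equiv> left_rep C"

lemma subgroup_C: "subgroup C P"
  using subgroup_U subgroup_V by (rule subgroups_Inter_pair)

definition normal :: "'a list \<Rightarrow> bool" where
  "normal w \<longleftrightarrow> alt w \<and> (\<forall>s\<in>set w. coset_rep s = s)"

lemma normal_ConsD: "normal (s # w) \<Longrightarrow> normal w \<and> coset_rep s = s"
  by (simp add: normal_def alternating_Cons)

lemma normalize:
  assumes "alt w" "c \<in> C"
  shows "\<exists>w' c'. normal w' \<and> c' \<in> C \<and> c \<otimes> word_prod w = word_prod w' \<otimes> c' \<and>
    map (\<lambda>s. s \<in> U) w' = map (\<lambda>s. s \<in> U) w"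
  using assms
proof (induction w arbitrary: c)
  case Nil
  then show ?case by (intro exI[of _ "[]"] exI[of _ c]) (simp add: normal_def)
next
  case (Cons s w)
  then have w: "alt w" "set w \<subseteq> carrier P" and s: "s \<in> (U - V) \<union> (V - U)" "s \<in> carrier P"
    using alt_carrier[OF Cons.prems(1)] by (auto simp: alternating_Cons)
  let ?r = "coset_rep (c \<otimes> s)"
  obtain d where d: "d \<in> C" "?r = c \<otimes> s \<otimes> d" using left_rep_eq[OF subgroup_C, of "c \<otimes> s"] s Cons.prems(2) by auto
  obtain w' c' where w': "normal w'" "c' \<in> C" "inv d \<otimes> word_prod w = word_prod w' \<otimes> c'"
    "map (\<lambda>s. s \<in> U) w' = map (\<lambda>s. s \<in> U) w"
    using Cons.IH[OF w(1), of "inv d"] d by auto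
  have side: "?r \<in> U \<longleftrightarrow> s \<in> U" "?r \<in> V \<longleftrightarrow> s \<in> V"
    using d s Cons.prems by (simp_all add: U_cancel_left U_cancel_right V_cancel_left V_cancel_right)
  have "w = [] \<longleftrightarrow> w' = []" "w \<noteq> [] \<Longrightarrow> (hd w' \<in> U) = (hd w \<in> U)"
    using w'(4) by (cases w; cases w'; auto)+
  then have "alt (?r # w')" using Cons.prems(1) w' side by (auto simp: alternating_Cons normal_def)
  moreover have "coset_rep ?r = ?r"
    using d s Cons.prems(2) by (simp add: left_rep_mult[OF subgroup_C])
  ultimately have "normal (?r # w')" using w' by (simp add: normal_def)
  moreover have "c \<otimes> word_prod (s # w) = ?r \<otimes> (inv d \<otimes> word_prod w)"
    using d s w Cons.prems(2) by (simp add: m_assoc) (simp add: m_assoc[symmetric])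
  moreover have "\<dots> = word_prod (?r # w') \<otimes> c'"
    using w' d s Cons.prems(2) alt_carrier[of w'] by (simp add: m_assoc normal_def)
  ultimately show ?case using w' side by (intro exI[of _ "?r # w'"] exI[of _ c']) simp
qed

lemma normal_form_exists: "g \<in> carrier P \<Longrightarrow> \<exists>w. normal w \<and> (\<exists>c\<in>C. g = word_prod w \<otimes> c)"
proof -
  assume "g \<in> carrier P"
  then obtain w d where g: "alt w" "d \<in> C" "g = word_prod w \<otimes> d" using normal_form by blast
  then obtain w' c' where "normal w'" "c' \<in> C" "word_prod w = word_prod w' \<otimes> c'"
    using normalize[of w \<one>] by auto
  moreover from this have "g = word_prod w' \<otimes> (c' \<otimes> d)"
    using g alt_carrier[of w'] by (simp add: m_assoc normal_def)
  ultimately show ?thesis using g by (intro exI[of _ w'] conjI bexI[of _ "c' \<otimes> d"]) auto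
qed

text \<open>
  For normal words, twice the number of common initial letters, plus one if the next letters differ but
  come from the same factor. Letters of a normal word are edges of a path in the Bass-Serre tree and
  factors are its vertices, so this counts the initial vertices and edges shared by two paths: it is twice
  the Gromov product.
\<close>

fun overlap :: "'a list \<Rightarrow> 'a list \<Rightarrow> nat" where
  "overlap (s # u) (t # v) =
     (if s = t then 2 + overlap u v else if (s \<in> U) = (t \<in> U) then 1 else 0)"
| "overlap _ _ = 0"

text \<open>
  Two paths that agree with a third one up to some point agree with each other up to that point.
\<close>

lemma overlap_ultrametric: "min (overlap u v) (overlap v w) \<le> overlap u w"
proof (induction u v arbitrary: w rule: overlap.induct)
  case (1 s u t v)
  show ?case
  proof (cases w)
    case (Cons r w')
    then show ?thesis using 1[of w'] by auto
  qed simp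
qed simp_all

text \<open>
  Equal initial letters cancel. At the first difference two letters from the same factor merge into one,
  which stays outside the intersection because distinct representatives lie in distinct cosets; letters
  from different factors do not interact at all.
\<close>

lemma len_normal:
  "normal u \<Longrightarrow> normal v \<Longrightarrow> len (inv (word_prod u) \<otimes> word_prod v) + overlap u v = length u + length v"
proof (induction u v rule: overlap.induct)
  case (1 s u t v)
  have u: "alt (s # u)" "alt u" "set u \<subseteq> carrier P" "s \<in> carrier P" "s \<in> (U - V) \<union> (V - U)"
    and v: "alt (t # v)" "alt v" "set v \<subseteq> carrier P" "t \<in> carrier P" "t \<in> (U - V) \<union> (V - U)"
    using 1(2,3) alt_carrier[of "s # u"] alt_carrier[of "t # v"]
    by (auto simp: normal_def alternating_Cons)
  have iu: "set (inv_word u) \<subseteq> carrier P" using u(3) by auto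
  have e: "inv (word_prod (s # u)) \<otimes> word_prod (t # v)
      = inv (word_prod u) \<otimes> ((inv s \<otimes> t) \<otimes> word_prod v)"
    using u v by (simp add: inv_mult_group m_assoc)
  show ?case
  proof (cases "s = t")
    case True
    then have "inv (word_prod (s # u)) \<otimes> word_prod (t # v) = inv (word_prod u) \<otimes> word_prod v"
      unfolding e using u v by simp
    then show ?thesis using True 1 normal_ConsD by simp
  next
    case st: False
    show ?thesis
    proof (cases "(s \<in> U) = (t \<in> U)")
      case True
      have "inv s \<otimes> t \<notin> C"
      proof
        assume "inv s \<otimes> t \<in> C"
        then have "coset_rep (s \<otimes> (inv s \<otimes> t)) = coset_rep s"
          using u by (intro left_rep_mult[OF subgroup_C])
        moreover have "s \<otimes> (inv s \<otimes> t) = t" using u v by (simp add: m_assoc[symmetric])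
        ultimately show False using st 1(2,3) normal_ConsD by metis
      qed
      then have l: "inv s \<otimes> t \<in> (U - V) \<union> (V - U)" and lu: "inv s \<otimes> t \<in> U \<longleftrightarrow> s \<in> U"
        using u v True by (auto simp: U_cancel_right inv_mem_U)
      have "u \<noteq> [] \<Longrightarrow> last (inv_word u) \<in> U \<longleftrightarrow> hd u \<in> U"
        using u(3) by (simp add: last_rev hd_map inv_mem_U subset_iff)
      then have "alt (inv_word u @ (inv s \<otimes> t) # v)"
        using l lu u(1,2) v(1,2) True
        by (auto simp: alternating_append alternating_Cons)
      then have "len (word_prod (inv_word u @ (inv s \<otimes> t) # v)) = length u + 1 + length v"
        using len_word_prod by fastforce
      moreover have "word_prod (inv_word u @ (inv s \<otimes> t) # v) =
          inv (word_prod u) \<otimes> ((inv s \<otimes> t) \<otimes> word_prod v)"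
        using u v iu by (subst word_prod_append) (simp_all add: word_prod_inv_word)
      ultimately show ?thesis unfolding e using st True by simp
    next
      case False
      have "alt (inv_word (s # u) @ (t # v))"
        unfolding alternating_append[of U V "inv_word (s # u)"]
        using False alt_inv_word[OF u(1)] u(4) v(1) by (simp add: inv_mem_U)
      then have "len (word_prod (inv_word (s # u) @ (t # v))) = length u + 1 + (length v + 1)"
        using len_word_prod by fastforce
      moreover have "word_prod (inv_word (s # u) @ (t # v)) =
          inv (word_prod (s # u)) \<otimes> word_prod (t # v)"
        using u v iu by (subst word_prod_append) (simp_all add: word_prod_inv_word[of "s # u", simplified] subset_iff)
      ultimately show ?thesis using st False by simp
    qed
  qed
next
  case ("2_1" v)
  then show ?case by (simp add: normal_def len_word_prod)
next
  case ("2_2" u)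
  then show ?case by (simp add: normal_def len_word_prod len_inv)
qed

definition nf :: "'a \<Rightarrow> 'a list" where
  "nf g = (SOME w. normal w \<and> (\<exists>c\<in>C. g = word_prod w \<otimes> c))"

lemma len_nf:
  assumes "x \<in> carrier P" "y \<in> carrier P"
  shows "len (inv x \<otimes> y) + overlap (nf x) (nf y) = len x + len y"
proof -
  have nf: "normal (nf g) \<and> (\<exists>c\<in>C. g = word_prod (nf g) \<otimes> c)" if "g \<in> carrier P" for g
    unfolding nf_def by (rule someI_ex) (rule normal_form_exists[OF that])
  obtain c d where c: "c \<in> C" "x = word_prod (nf x) \<otimes> c" and d: "d \<in> C" "y = word_prod (nf y) \<otimes> d"
    using nf assms by blast
  have n: "normal (nf x)" "normal (nf y)" using nf assms by auto
  let ?u = "word_prod (nf x)" and ?v = "word_prod (nf y)"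
  have uv: "?u \<in> carrier P" "?v \<in> carrier P" using n by (simp_all add: normal_def)
  have "inv x \<otimes> y = (inv c \<otimes> (inv ?u \<otimes> ?v)) \<otimes> d"
    using c(1) d(1) uv by (subst c(2), subst d(2)) (simp add: inv_mult_group m_assoc)
  then have "len (inv x \<otimes> y) = len (inv ?u \<otimes> ?v)"
    using c(1) d(1) uv by (simp add: len_mult_C_left len_mult_C_right)
  moreover have "len x = length (nf x)" "len y = length (nf y)"
    using n c d len_word unfolding normal_def by metis+
  ultimately show ?thesis using len_normal[OF n] by simp
qed

lemma len_triangle: "x \<in> carrier P \<Longrightarrow> y \<in> carrier P \<Longrightarrow> len (x \<otimes> y) \<le> len x + len y"
  using len_nf[of "inv x" y] by (simp add: len_inv)

text \<open>
  The four point condition for the tree metric \<open>(x, y) \<mapsto> len (inv x \<otimes> y)\<close>, applied to four points that are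
  successively translated by \<open>u\<close>, \<open>w\<close> and \<open>v\<close>: of the three sums over opposite pairs, the two largest
  are equal. It is the ultrametric inequality for Gromov products in symmetric form. All geometry of the
  tree that is used below enters through these inequalities.
\<close>

lemma four_point:
  assumes "u \<in> carrier P" "w \<in> carrier P" "v \<in> carrier P"
  shows "len (u \<otimes> w \<otimes> v) + len w \<le> max (len (u \<otimes> w) + len (w \<otimes> v)) (len u + len v)"
    and "len (u \<otimes> w) + len (w \<otimes> v) \<le> max (len (u \<otimes> w \<otimes> v) + len w) (len u + len v)"
    and "len u + len v \<le> max (len (u \<otimes> w \<otimes> v) + len w) (len (u \<otimes> w) + len (w \<otimes> v))"
proof -
  let ?x = "nf (inv u)" and ?y = "nf w" and ?z = "nf (w \<otimes> v)"
  have 1: "len (u \<otimes> w) + overlap ?x ?y = len u + len w"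
    using len_nf[of "inv u" w] assms by (simp add: len_inv)
  have 2: "len (u \<otimes> w \<otimes> v) + overlap ?x ?z = len u + len (w \<otimes> v)"
    using len_nf[of "inv u" "w \<otimes> v"] assms by (simp add: len_inv m_assoc)
  have 3: "len v + overlap ?y ?z = len w + len (w \<otimes> v)"
    using len_nf[of w "w \<otimes> v"] assms by (simp add: m_assoc[symmetric])
  have 4: "len (u \<otimes> w) + overlap ?y ?x = len u + len w"
    using len_nf[of w "inv u"] assms len_inv[of "u \<otimes> w"]
    by (simp add: len_inv inv_mult_group add.commute)
  have 5: "len v + overlap ?z ?y = len w + len (w \<otimes> v)"
    using len_nf[of "w \<otimes> v" w] assms len_inv[of v]
    by (simp add: inv_mult_group m_assoc add.commute)
  show "len (u \<otimes> w \<otimes> v) + len w \<le> max (len (u \<otimes> w) + len (w \<otimes> v)) (len u + len v)"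
    using overlap_ultrametric[of ?x ?y ?z] 1 2 3 by linarith
  show "len (u \<otimes> w) + len (w \<otimes> v) \<le> max (len (u \<otimes> w \<otimes> v) + len w) (len u + len v)"
    using overlap_ultrametric[of ?x ?z ?y] 1 2 5 by linarith
  show "len u + len v \<le> max (len (u \<otimes> w \<otimes> v) + len w) (len (u \<otimes> w) + len (w \<otimes> v))"
    using overlap_ultrametric[of ?y ?x ?z] 2 3 4 by linarith
qed

end

section \<open>Conjugates, centralizers and translation in an amalgam\<close>

definition (in group) conj_by :: "'a \<Rightarrow> 'a \<Rightarrow> 'a" where
  "conj_by t x = t \<otimes> x \<otimes> inv t"

text \<open>
  For a fixed \<open>a\<close>, the two conditions of the characterization above. Both are invariant under
  conjugation, so they need only be checked for one representative of each conjugacy class.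
\<close>

definition (in group) abelian_centralizer :: "'a \<Rightarrow> bool" where
  "abelian_centralizer a \<longleftrightarrow> (\<forall>x\<in>carrier G. \<forall>y\<in>carrier G. x \<otimes> a = a \<otimes> x \<longrightarrow>
     y \<otimes> a = a \<otimes> y \<longrightarrow> x \<otimes> y = y \<otimes> x)"

definition (in group) separated :: "'a \<Rightarrow> bool" where
  "separated a \<longleftrightarrow> (\<forall>x\<in>carrier G. a \<otimes> conj_by x a = conj_by x a \<otimes> a \<longrightarrow> x \<otimes> a = a \<otimes> x)"

context group
begin

lemma conj_by_closed [simp]: "t \<in> carrier G \<Longrightarrow> x \<in> carrier G \<Longrightarrow> conj_by t x \<in> carrier G"
  by (simp add: conj_by_def)

lemma cancel_inv_left:
  "t \<in> carrier G \<Longrightarrow> x \<in> carrier G \<Longrightarrow> inv t \<otimes> (t \<otimes> x) = x"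
  "t \<in> carrier G \<Longrightarrow> x \<in> carrier G \<Longrightarrow> t \<otimes> (inv t \<otimes> x) = x"
  by (simp_all add: m_assoc[symmetric])

lemma conj_by_mult:
  "t \<in> carrier G \<Longrightarrow> x \<in> carrier G \<Longrightarrow> y \<in> carrier G \<Longrightarrow>
    conj_by t (x \<otimes> y) = conj_by t x \<otimes> conj_by t y"
  by (simp add: conj_by_def m_assoc cancel_inv_left)

lemma conj_by_compose:
  "s \<in> carrier G \<Longrightarrow> t \<in> carrier G \<Longrightarrow> x \<in> carrier G \<Longrightarrow>
    conj_by s (conj_by t x) = conj_by (s \<otimes> t) x"
  by (simp add: conj_by_def m_assoc inv_mult_group)

lemma conj_by_one [simp]: "t \<in> carrier G \<Longrightarrow> conj_by t \<one> = \<one>"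
  by (simp add: conj_by_def)

lemma conj_by_one_left [simp]: "x \<in> carrier G \<Longrightarrow> conj_by \<one> x = x"
  by (simp add: conj_by_def)

lemma conj_by_inverse [simp]:
  "t \<in> carrier G \<Longrightarrow> x \<in> carrier G \<Longrightarrow> conj_by (inv t) (conj_by t x) = x"
  by (simp add: conj_by_compose)

lemma conj_by_eq_iff:
  assumes "t \<in> carrier G" "x \<in> carrier G" "y \<in> carrier G"
  shows "conj_by t x = conj_by t y \<longleftrightarrow> x = y"
  using conj_by_inverse[of t x] conj_by_inverse[of t y] assms by metis

lemma conj_by_eq_self_iff:
  "t \<in> carrier G \<Longrightarrow> x \<in> carrier G \<Longrightarrow> conj_by t x = x \<longleftrightarrow> t \<otimes> x = x \<otimes> t"
  by (simp add: conj_by_def inv_solve_right')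

lemma conj_by_commute_iff:
  "t \<in> carrier G \<Longrightarrow> x \<in> carrier G \<Longrightarrow> y \<in> carrier G \<Longrightarrow>
    conj_by t x \<otimes> conj_by t y = conj_by t y \<otimes> conj_by t x \<longleftrightarrow> x \<otimes> y = y \<otimes> x"
  by (simp add: conj_by_mult[symmetric] conj_by_eq_iff)

lemma conj_by_pow:
  "t \<in> carrier G \<Longrightarrow> x \<in> carrier G \<Longrightarrow> conj_by t (x [^] (n::nat)) = conj_by t x [^] n"
  by (induction n) (simp_all add: conj_by_mult)

lemma commute_pow:
  "x \<in> carrier G \<Longrightarrow> y \<in> carrier G \<Longrightarrow> x \<otimes> y = y \<otimes> x \<Longrightarrow> x [^] (n::nat) \<otimes> y = y \<otimes> x [^] n"
  by (induction n) (simp_all add: commute_mult)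

lemma abelian_centralizer_conj_by:
  assumes "abelian_centralizer (conj_by t a)" "t \<in> carrier G" "a \<in> carrier G"
  shows "abelian_centralizer a"
  unfolding abelian_centralizer_def
proof (intro ballI impI)
  fix x y assume x: "x \<in> carrier G" "x \<otimes> a = a \<otimes> x" and y: "y \<in> carrier G" "y \<otimes> a = a \<otimes> y"
  have "conj_by t x \<otimes> conj_by t y = conj_by t y \<otimes> conj_by t x"
    using assms(1) x y assms(2,3) conj_by_commute_iff conj_by_closed
    unfolding abelian_centralizer_def by metis
  then show "x \<otimes> y = y \<otimes> x" using x y assms(2) by (simp add: conj_by_commute_iff)
qed

lemma separated_conj_by:
  assumes "separated (conj_by t a)" "t \<in> carrier G" "a \<in> carrier G"
  shows "separated a"
  unfolding separated_def
proof (intro ballI impI)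
  fix x assume x: "x \<in> carrier G" "a \<otimes> conj_by x a = conj_by x a \<otimes> a"
  have e: "conj_by (conj_by t x) (conj_by t a) = conj_by t (conj_by x a)"
    using assms(2,3) x(1) by (simp add: conj_by_compose) (simp add: conj_by_def m_assoc)
  have "conj_by t a \<otimes> conj_by t (conj_by x a) = conj_by t (conj_by x a) \<otimes> conj_by t a"
    using x assms(2,3) by (simp add: conj_by_commute_iff)
  then have "conj_by t x \<otimes> conj_by t a = conj_by t a \<otimes> conj_by t x"
    using assms x(1) conj_by_closed unfolding separated_def e[symmetric] by metis
  then show "x \<otimes> a = a \<otimes> x" using x assms(2,3) by (simp add: conj_by_commute_iff)
qed

text \<open>
  If no conjugation from outside \<open>K\<close> brings \<open>a\<close> back into \<open>K\<close>, then the centralizer of \<open>a\<close> lies in \<open>K\<close>,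
  and so does any \<open>x\<close> whose conjugate of \<open>a\<close> commutes with \<open>a\<close>: that conjugate centralizes \<open>a\<close>, hence
  belongs to \<open>K\<close>. Thus both conditions are inherited from \<open>K\<close>.
\<close>

lemma isolated_in_subgroup:
  assumes K: "K \<subseteq> carrier G" "commutative_transitive G K" "conjugation_separated G K"
    and a: "a \<in> K" "a \<noteq> \<one>" and iso: "\<And>z. z \<in> carrier G \<Longrightarrow> conj_by z a \<in> K \<Longrightarrow> z \<in> K"
  shows "abelian_centralizer a" "separated a"
proof -
  have ac: "a \<in> carrier G" using a K by blast
  have cent: "x \<in> K" if "x \<in> carrier G" "x \<otimes> a = a \<otimes> x" for x
    using iso[OF that(1)] conj_by_eq_self_iff[OF that(1) ac] that a by simp
  then show "abelian_centralizer a"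
    using K(2) a unfolding abelian_centralizer_def commutative_transitive_def by blast
  have "x \<in> K" if "x \<in> carrier G" "a \<otimes> conj_by x a = conj_by x a \<otimes> a" for x
    using iso[OF that(1)] cent[of "conj_by x a"] that ac by simp
  then show "separated a"
    using K(3) a unfolding separated_def conjugation_separated_def conj_by_def by blast
qed

end

context amalgam_decomposition
begin

text \<open>
  The commutator is spelled by an alternating word of length four. This is the obstruction in the
  direction from the amalgam to the factors.
\<close>

lemma not_commute:
  assumes "x \<in> U - V" "y \<in> V - U"
  shows "x \<otimes> y \<noteq> y \<otimes> x"
proof
  assume "x \<otimes> y = y \<otimes> x"
  then have "word_prod [x, y, inv x, inv y] = y \<otimes> x \<otimes> (inv x \<otimes> inv y)"
    using assms by (auto simp: m_assoc[symmetric])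
  then have "word_prod [x, y, inv x, inv y] = \<one>"
    using assms by (auto simp: m_assoc cancel_inv_left)
  moreover have "alt [x, y, inv x, inv y]"
    using assms by (auto simp: alternating_Cons inv_mem_U inv_mem_V)
  then have "len (word_prod [x, y, inv x, inv y]) = 4" using len_word_prod by fastforce
  moreover have "len \<one> = 0" using len_word[of "[]" \<one>] by simp
  ultimately show False by simp
qed

lemma strip_last:
  assumes "z \<in> carrier P"
  shows "\<exists>w k. alt w \<and> k \<in> V \<and> z = word_prod w \<otimes> k \<and> (w = [] \<or> last w \<in> U - V)"
proof -
  obtain w c where z: "alt w" "c \<in> C" "z = word_prod w \<otimes> c" using normal_form assms by blast
  show ?thesis
  proof (cases "w = [] \<or> last w \<in> U - V")
    case True
    then show ?thesis using z by blast
  next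
    case False
    then obtain v s where w: "w = v @ [s]" by (metis rev_exhaust)
    then have "alt v" "s \<in> V - U" "v = [] \<or> (last v \<in> U) \<noteq> (s \<in> U)"
      using z(1) False by (auto simp: alternating_append alternating_Cons)
    moreover from this have "v \<noteq> [] \<Longrightarrow> last v \<in> (U - V) \<union> (V - U)"
      using last_in_set by (auto simp: alternating_def)
    ultimately have v: "alt v" "s \<in> V" "v = [] \<or> last v \<in> U - V" by auto
    moreover have "z = word_prod v \<otimes> (s \<otimes> c)"
      using v z w by (simp add: word_prod_append m_assoc)
    ultimately show ?thesis using z(2) by (intro exI[of _ v] exI[of _ "s \<otimes> c"]) auto
  qed
qed

lemma conj_by_word:
  assumes "alt w" "k \<in> carrier P" "a \<in> carrier P"
  shows "conj_by (word_prod w \<otimes> k) a = word_prod w \<otimes> conj_by k a \<otimes> inv (word_prod w)"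
  using assms by (simp add: conj_by_def inv_mult_group m_assoc)

text \<open>
  Write \<open>z\<close> as an alternating word ending outside \<open>V\<close>, times some \<open>k \<in> V\<close>. If conjugation by \<open>k\<close> does not
  move \<open>a\<close> into the intersection, then conjugating further by the word yields length at least three,
  whereas elements of \<open>V\<close> have length at most one.
\<close>

lemma conjugate_into_C:
  assumes a: "a \<in> V" and z: "z \<in> carrier P" "z \<notin> V" "conj_by z a \<in> V"
  shows "\<exists>k\<in>V. conj_by k a \<in> C"
proof -
  obtain w k where w: "alt w" "k \<in> V" "z = word_prod w \<otimes> k" "w = [] \<or> last w \<in> U - V"
    using strip_last z by blast
  have b: "conj_by k a \<in> V" using a w by (simp add: conj_by_def)
  have "w \<noteq> []" using w z(2) by auto
  have "conj_by k a \<in> U"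
  proof (rule ccontr)
    assume "conj_by k a \<notin> U"
    then have "alt (w @ [conj_by k a])" using b w by (auto simp: alternating_append alternating_Cons)
    from len_conjugate_letter[OF this] have "len (conj_by z a) = 2 * length w + 1"
      using w a by (simp add: conj_by_word)
    then show False using len_le_1[of "conj_by z a"] z(3) \<open>w \<noteq> []\<close> by (cases w) auto
  qed
  then show ?thesis using w b by blast
qed

text \<open>
  Conjugation by the first letter shortens an alternating word whose first and last letters belong to the
  same factor. So the process stops at a single factor or at a word whose square is alternating.
\<close>

lemma elliptic_or_cyclically_reduced:
  assumes "g \<in> carrier P"
  shows "\<exists>t\<in>carrier P. conj_by t g \<in> U \<union> V \<or>
    (\<exists>w. w \<noteq> [] \<and> alt (w @ w) \<and> conj_by t g = word_prod w)"
  using assms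
proof (induction "len g" arbitrary: g rule: less_induct)
  case less
  obtain w c where g: "alt w" "c \<in> C" "g = word_prod w \<otimes> c" using normal_form less.prems by blast
  show ?case
  proof (cases w rule: rev_cases)
    case Nil
    then show ?thesis using g by (intro bexI[of _ \<one>]) auto
  next
    case (snoc v t)
    then have vt: "alt v" "t \<in> (U - V) \<union> (V - U)" "t \<in> carrier P"
      using g(1) by (auto simp: alternating_append alternating_Cons)
    define r where "r = t \<otimes> c"
    have r: "r \<in> U \<longleftrightarrow> t \<in> U" "r \<in> V \<longleftrightarrow> t \<in> V" "r \<in> carrier P"
      using vt g(2) unfolding r_def by (auto simp: U_cancel_right V_cancel_right)
    have gr: "g = word_prod (v @ [r])" using g vt snoc by (simp add: word_prod_append m_assoc r_def)
    have alt: "alt (v @ [r])"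
      using g(1) r unfolding snoc by (auto simp: alternating_append alternating_Cons)
    show ?thesis
    proof (cases v)
      case Nil
      then have "conj_by \<one> g \<in> U \<union> V" using gr r vt by auto
      then show ?thesis by blast
    next
      case (Cons s u)
      then have s: "s \<in> (U - V) \<union> (V - U)" "s \<in> carrier P" "alt u"
        using vt(1) by (auto simp: alternating_Cons)
      show ?thesis
      proof (cases "(s \<in> U) = (r \<in> U)")
        case True
        have e: "conj_by (inv s) g = word_prod u \<otimes> (r \<otimes> s)"
          using s r unfolding conj_by_def gr Cons
          by (simp add: word_prod_append m_assoc cancel_inv_left)
        have "r \<otimes> s \<in> U \<union> V" using True s r vt by auto
        then have "len (r \<otimes> s) \<le> 1" by (rule len_le_1)
        then have "len (conj_by (inv s) g) \<le> length u + 1"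
          unfolding e using len_triangle[of "word_prod u" "r \<otimes> s"] s r len_word_prod[of u] by simp
        moreover have "len g = length u + 2" unfolding gr using len_word_prod[OF alt] Cons by simp
        ultimately obtain t' where "t' \<in> carrier P" and
          "conj_by t' (conj_by (inv s) g) \<in> U \<union> V \<or>
           (\<exists>w. w \<noteq> [] \<and> alt (w @ w) \<and> conj_by t' (conj_by (inv s) g) = word_prod w)"
          using less.hyps[of "conj_by (inv s) g"] s less.prems by auto
        then show ?thesis
          using s less.prems by (intro bexI[of _ "t' \<otimes> inv s"]) (simp_all add: conj_by_compose)
      next
        case False
        have "alt ((v @ [r]) @ (v @ [r]))"
          unfolding alternating_append[of U V "v @ [r]"] using alt False Cons by simp
        then show ?thesis
          using gr less.prems by (intro bexI[of _ \<one>] disjI2 exI[of _ "v @ [r]"]) simp_all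
      qed
    qed
  qed
qed

lemma len_pow_cyclically_reduced:
  assumes "w \<noteq> []" "alt (w @ w)"
  shows "len (word_prod w [^] (n::nat)) = n * length w"
proof -
  have w: "alt w" "set w \<subseteq> carrier P" using assms alt_carrier[of w] by (auto simp: alternating_append)
  have "alt (concat (replicate n w)) \<and> (n > 0 \<longrightarrow> hd (concat (replicate n w)) = hd w) \<and>
      word_prod w [^] n = word_prod (concat (replicate n w))"
  proof (induction n)
    case (Suc n)
    have "set (concat (replicate n w)) \<subseteq> carrier P" using w(2) by (cases "n = 0") auto
    moreover have "alt (w @ concat (replicate n w))"
      using Suc assms w by (cases "n = 0") (auto simp: alternating_append[of U V w])
    moreover have "word_prod w [^] Suc n = word_prod w \<otimes> word_prod w [^] n"
      by (rule nat_pow_Suc2) (use w in simp)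
    ultimately show ?case
      using Suc assms(1) w by (simp add: word_prod_append del: nat_pow_Suc)
  qed simp
  then have "alt (concat (replicate n w))" "word_prod w [^] n = word_prod (concat (replicate n w))"
    by simp_all
  then show ?thesis by (simp add: len_word_prod length_concat sum_list_replicate)
qed

lemma len_ge_2_cyclically_reduced:
  assumes "w \<noteq> []" "alt (w @ w)"
  shows "length w \<ge> 2"
proof (cases w)
  case (Cons s v)
  then show ?thesis using assms by (cases v) (auto simp: alternating_Cons)
qed (use assms in simp)

text \<open>
  A Busemann function of the end of the tree to which the powers of \<open>g\<close> converge, evaluated at the
  image of the base edge under the inverse of \<open>z\<close>. For \<open>z\<close> in the centralizer of \<open>g\<close> it is the signed
  distance by which \<open>z\<close> moves along the axis of \<open>g\<close>.
\<close>

definition translation :: "'a \<Rightarrow> 'a \<Rightarrow> int \<Rightarrow> bool" where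
  "translation g z t \<longleftrightarrow>
     (\<forall>\<^sub>F n in sequentially. int (len (z \<otimes> g [^] (n::nat))) = int n * int (len g) + t)"

text \<open>
  The difference defining the limit decreases in \<open>n\<close> and is bounded below, both by the triangle
  inequality; being integral, it is eventually constant.
\<close>

lemma translation_exists:
  assumes g: "g \<in> carrier P" "\<And>n::nat. len (g [^] n) = n * len g" and z: "z \<in> carrier P"
  shows "\<exists>t. translation g z t"
proof -
  define f where "f n = len (z \<otimes> g [^] n) + len z - n * len g" for n :: nat
  have low: "n * len g \<le> len (z \<otimes> g [^] n) + len z" for n :: nat
    using len_triangle[of "inv z" "z \<otimes> g [^] n"] g z by (simp add: cancel_inv_left len_inv)
  have "f (Suc n) \<le> f n" for n
    using len_triangle[of "z \<otimes> g [^] n" g] g z low[of n] low[of "Suc n"]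
    by (simp add: f_def m_assoc)
  then have dec: "f n \<le> f m" if "m \<le> n" for m n using that by (rule lift_Suc_antimono_le)
  obtain m where m: "\<And>n. f m \<le> f n" using ex_has_least_nat[of "\<lambda>_. True" 0 f] by auto
  have "f n = f m" if "n \<ge> m" for n using dec[OF that] m[of n] by simp
  then have "int (len (z \<otimes> g [^] n)) = int n * int (len g) + (int (f m) - int (len z))" if "n \<ge> m" for n
    using \<open>\<And>n. n \<ge> m \<Longrightarrow> f n = f m\<close>[OF that] low[of n] unfolding f_def[of n] of_nat_mult[symmetric] by linarith
  then show ?thesis unfolding translation_def eventually_sequentially by blast
qed

lemma translation_unique:
  assumes "translation g z s" "translation g z t"
  shows "s = t"
  using eventually_happens'[OF sequentially_bot eventually_conj[OF assms[unfolded translation_def]]]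
  by auto

text \<open>
  The four point condition for \<open>z\<close>, a large power of \<open>g\<close>, and \<open>w\<close>: the sum \<open>len z + len w\<close> is
  eventually the smallest of the three, so the other two agree. As \<open>w\<close> commutes with \<open>g\<close>, this is additivity.
\<close>

lemma translation_mult:
  assumes g: "g \<in> carrier P" "len g > 0" "\<And>n::nat. len (g [^] n) = n * len g"
    and z: "z \<in> carrier P" "translation g z s"
    and w: "w \<in> carrier P" "g \<otimes> w = w \<otimes> g" "translation g w t"
  shows "translation g (z \<otimes> w) (s + t)"
  unfolding translation_def
proof (rule eventually_mono)
  show "\<forall>\<^sub>F n in sequentially. (int (len (z \<otimes> g [^] n)) = int n * int (len g) + s \<and>
      int (len (w \<otimes> g [^] n)) = int n * int (len g) + t) \<and> n > len z + len w + nat \<bar>s + t\<bar>"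
    using z(2) w(3) unfolding translation_def by (intro eventually_conj eventually_gt_at_top)
  fix n :: nat
  assume n: "(int (len (z \<otimes> g [^] n)) = int n * int (len g) + s \<and>
      int (len (w \<otimes> g [^] n)) = int n * int (len g) + t) \<and> n > len z + len w + nat \<bar>s + t\<bar>"
  have c: "g [^] n \<otimes> w = w \<otimes> g [^] n" using commute_pow g w by simp
  have e: "z \<otimes> w \<otimes> g [^] n = z \<otimes> g [^] n \<otimes> w" using g z w by (simp add: m_assoc c)
  define K where "K = int n * int (len g)"
  have "int n \<le> K"
    using g(2) mult_left_mono[of 1 "int (len g)" "int n"] by (simp add: K_def)
  moreover have "int (len (g [^] n)) = K" by (simp add: g(3) K_def)
  ultimately show "int (len (z \<otimes> w \<otimes> g [^] n)) = int n * int (len g) + (s + t)"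
    using four_point(1,2)[OF z(1) nat_pow_closed[OF g(1), of n] w(1), unfolded c]
      n[THEN conjunct1, THEN conjunct1] n[THEN conjunct1, THEN conjunct2] n[THEN conjunct2]
    unfolding K_def[symmetric] e by linarith
qed

lemma translation_one:
  assumes "g \<in> carrier P" "\<And>n::nat. len (g [^] n) = n * len g"
  shows "translation g \<one> 0"
  using assms by (simp add: translation_def)

lemma translation_self:
  assumes "g \<in> carrier P" "\<And>n::nat. len (g [^] n) = n * len g"
  shows "translation g g (int (len g))"
proof -
  have "len (g \<otimes> g [^] n) = n * len g + len g" for n :: nat
    using assms(2)[of "Suc n"] nat_pow_Suc2[OF assms(1), of n] by simp
  then show ?thesis by (simp add: translation_def)
qed

lemma translation_inv:
  assumes g: "g \<in> carrier P" "len g > 0" "\<And>n::nat. len (g [^] n) = n * len g"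
    and z: "z \<in> carrier P" "g \<otimes> z = z \<otimes> g" "translation g z t"
  shows "translation g (inv z) (- t)"
proof -
  obtain s where s: "translation g (inv z) s" using translation_exists[of g "inv z"] g z by auto
  have "g \<otimes> inv z = inv z \<otimes> g" using commute_inv[of z g] g z by simp
  then have "translation g (z \<otimes> inv z) (t + s)"
    using translation_mult[OF g z(1,3) inv_closed[OF z(1)] _ s] by blast
  then have "t + s = 0" using translation_one[OF g(1,3)] translation_unique z(1) by simp
  then have "s = - t" by simp
  with s show ?thesis by simp
qed

lemma translation_pow:
  assumes g: "g \<in> carrier P" "len g > 0" "\<And>n::nat. len (g [^] n) = n * len g"
    and z: "z \<in> carrier P" "g \<otimes> z = z \<otimes> g" "translation g z t"
  shows "translation g (z [^] (n::nat)) (int n * t)"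
proof (induction n)
  case 0
  then show ?case using translation_one[OF g(1,3)] by simp
next
  case (Suc n)
  then have "translation g (z [^] n \<otimes> z) (int n * t + t)"
    using translation_mult[OF g nat_pow_closed[OF z(1)] _ z] by blast
  then show ?case by (simp add: algebra_simps)
qed

text \<open>
  The base edge lies on the axis of \<open>g\<close>, so the distance it is moved by an element of the centralizer
  is exactly the translation distance. The proof compares the base edge and its image under \<open>z\<close> with
  two far away points of the axis, one in each direction.
\<close>

lemma len_eq_translation:
  assumes g: "g \<in> carrier P" "len g > 0" "\<And>n::nat. len (g [^] n) = n * len g"
    and z: "z \<in> carrier P" "g \<otimes> z = z \<otimes> g" "translation g z t"
  shows "int (len z) = \<bar>t\<bar>"
proof -
  have "\<forall>\<^sub>F n in sequentially. int (len (z \<otimes> g [^] n)) = int n * int (len g) + t \<and>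
      int (len (inv z \<otimes> g [^] n)) = int n * int (len g) + - t"
    using z(3) translation_inv[OF g z] unfolding translation_def by (rule eventually_conj)
  from eventually_happens'[OF sequentially_bot this]
  obtain n :: nat where n: "int (len (z \<otimes> g [^] n)) = int n * int (len g) + t"
      "int (len (inv z \<otimes> g [^] n)) = int n * int (len g) + - t"
    by blast
  have c: "g [^] n \<otimes> z = z \<otimes> g [^] n" using commute_pow g z by simp
  have 1: "g [^] n \<otimes> z \<otimes> (inv z \<otimes> g [^] n) = g [^] (n + n)"
    using g z by (simp add: m_assoc cancel_inv_left nat_pow_mult)
  have 2: "z \<otimes> (inv z \<otimes> g [^] n) = g [^] n" using g z by (simp add: cancel_inv_left)
  define K where "K = int n * int (len g)"
  have K: "int (len (g [^] (n + n))) = 2 * K" "int (len (g [^] n)) = K"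
    unfolding g(3) K_def by (simp_all add: algebra_simps)
  have "g [^] n \<in> carrier P" "inv z \<otimes> g [^] n \<in> carrier P" using g z by simp_all
  note four_point[OF this(1) z(1) this(2), unfolded 1 2, unfolded c]
  then show ?thesis using n[folded K_def] K by linarith
qed

text \<open>
  Lengths of powers of conjugate elements differ by a bounded amount, so conjugates that both translate
  along the same axis do so by the same distance, up to direction.
\<close>

lemma conj_translation:
  assumes g: "g \<in> carrier P" "len g > 0" "\<And>n::nat. len (g [^] n) = n * len g"
    and x: "x \<in> carrier P" "g \<otimes> conj_by x g = conj_by x g \<otimes> g" "translation g (conj_by x g) t"
  shows "\<bar>t\<bar> = int (len g)"
proof -
  let ?b = "conj_by x g"
  have pow: "int (len (?b [^] n)) = int n * \<bar>t\<bar>" for n :: nat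
    using len_eq_translation[OF g, of "?b [^] n"] translation_pow[OF g _ x(2,3), of n] g(1) x(1,2)
      commute_pow[of ?b g n] by (simp add: abs_mult)
  have le: "len (conj_by y h) \<le> len h + 2 * len y" if "y \<in> carrier P" "h \<in> carrier P" for y h
    using len_triangle[of "y \<otimes> h" "inv y"] len_triangle[of y h] that by (simp add: conj_by_def len_inv)
  have up: "len (?b [^] n) \<le> n * len g + 2 * len x" for n :: nat
    using le[of x "g [^] n"] g x by (simp add: conj_by_pow)
  have lo: "n * len g \<le> len (?b [^] n) + 2 * len x" for n :: nat
    using le[of "inv x" "conj_by x (g [^] n)"] g x by (simp add: conj_by_pow len_inv)
  \<comment> \<open>The bound \<open>2 * len x\<close> holds for all powers, so a power exceeding it forces equality of integers.\<close>
  define N where "N = Suc (2 * len x)"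
  have "int N * \<bar>t\<bar> \<le> int N * int (len g) + 2 * int (len x)"
    "int N * int (len g) \<le> int N * \<bar>t\<bar> + 2 * int (len x)"
    using up[of N] lo[of N] pow[of N] by (simp_all add: of_nat_mult[symmetric] del: of_nat_mult)
  then have "int N * (\<bar>t\<bar> - int (len g)) < int N * 1" "int N * (int (len g) - \<bar>t\<bar>) < int N * 1"
    by (simp_all add: N_def algebra_simps)
  then have "\<bar>t\<bar> - int (len g) < 1" "int (len g) - \<bar>t\<bar> < 1"
    by (simp_all add: mult_less_cancel_left N_def)
  then show ?thesis by simp
qed

end

section \<open>Amalgams over a subgroup that is malnormal in one factor\<close>

text \<open>
  The symmetry between the factors is broken here: \<open>U\<close> plays the role of the factor in which the
  amalgamated subgroup is maximal abelian, and hence malnormal.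
\<close>

locale CSA_amalgam = amalgam_decomposition +
  assumes CSA_U: "commutative_transitive P U" "conjugation_separated P U" "involution_free P U"
    and CSA_V: "commutative_transitive P V" "conjugation_separated P V" "involution_free P V"
    and malnormal_C: "\<And>x c. x \<in> U - V \<Longrightarrow> c \<in> C \<Longrightarrow> conj_by x c \<in> C \<Longrightarrow> c = \<one>"
begin

text \<open>
  The other factor \<open>V\<close> inherits malnormality, in the whole amalgam. In the tree this says that a
  nontrivial element fixes at most one vertex of type \<open>V\<close>, since a path between two of them passes through
  a vertex of type \<open>U\<close>. In terms of words, a letter of \<open>U\<close> conjugates a nontrivial element of the
  intersection out of the intersection, and from then on conjugation only increases the length.
\<close>

lemma malnormal_V:
  assumes a: "a \<in> V" "a \<noteq> \<one>" and z: "z \<in> carrier P" "conj_by z a \<in> V"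
  shows "z \<in> V"
proof (rule ccontr)
  assume "z \<notin> V"
  obtain w k where w: "alt w" "k \<in> V" "z = word_prod w \<otimes> k" "w = [] \<or> last w \<in> U - V"
    using strip_last z by blast
  then obtain v x where wv: "w = v @ [x]" using \<open>z \<notin> V\<close> by (cases w rule: rev_cases) auto
  then have x: "x \<in> U - V" "alt v" using w by (auto simp: alternating_append)
  let ?b = "conj_by k a"
  have b: "?b \<in> V" "?b \<noteq> \<one>"
    using a w conj_by_eq_iff[of k a \<one>] by (auto simp: conj_by_def)
  have bz: "conj_by z a = word_prod w \<otimes> ?b \<otimes> inv (word_prod w)"
    using w a by (simp add: conj_by_word)
  show False
  proof (cases "?b \<in> U")
    case False
    then have "alt (w @ [?b])" using b w by (auto simp: alternating_append alternating_Cons)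
    from len_conjugate_letter[OF this] have "len (conj_by z a) = 2 * length w + 1"
      unfolding bz .
    then show False using len_le_1[of "conj_by z a"] z(2) wv by auto
  next
    case True
    let ?d = "conj_by x ?b"
    have "?d \<in> U" using x True by (simp add: conj_by_def)
    moreover have "?d \<notin> V" using malnormal_C[of x ?b] x True b \<open>?d \<in> U\<close> by blast
    ultimately have "alt (v @ [?d])"
      using w(1) x unfolding wv by (auto simp: alternating_append alternating_Cons)
    note len = len_conjugate_letter[OF this]
    have e: "conj_by z a = word_prod v \<otimes> ?d \<otimes> inv (word_prod v)"
      unfolding bz wv using x b by (simp add: word_prod_append conj_by_def m_assoc inv_mult_group)
    then have "length v = 0"
      using len len_le_1[of "conj_by z a"] z(2) by simp
    then show False using e \<open>?d \<in> U\<close> \<open>?d \<notin> V\<close> z(2) by simp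
  qed
qed

lemma V_element:
  assumes "a \<in> V" "a \<noteq> \<one>"
  shows "abelian_centralizer a" "separated a"
proof -
  have "V \<subseteq> carrier P" by auto
  from isolated_in_subgroup[OF this CSA_V(1,2) assms malnormal_V[OF assms]]
  show "abelian_centralizer a" "separated a" by blast+
qed

text \<open>
  An element of \<open>U\<close> either is conjugate into \<open>V\<close>, or cannot be brought back into \<open>U\<close> by any conjugation from
  outside \<open>U\<close>. Either way both conditions are inherited from a factor.
\<close>

lemma elliptic_element:
  assumes a: "a \<in> U \<union> V" "a \<noteq> \<one>"
  shows "abelian_centralizer a \<and> separated a"
proof (cases "\<exists>k\<in>U. conj_by k a \<in> V")
  case True
  then obtain k where k: "k \<in> U" "conj_by k a \<in> V" by blast
  have ac: "a \<in> carrier P" using a by auto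
  then have "conj_by k a \<noteq> \<one>" using conj_by_eq_iff[of k a \<one>] k a by auto
  then show ?thesis
    using V_element[of "conj_by k a"] abelian_centralizer_conj_by separated_conj_by k ac by auto
next
  case False
  then have "a \<in> U" using a by (metis U_closed(1) UnE V_carrier conj_by_one_left)
  have iso: "z \<in> U" if "z \<in> carrier P" "conj_by z a \<in> U" for z
    using amalgam_decomposition.conjugate_into_C[OF swap \<open>a \<in> U\<close> that(1) _ that(2)] False by blast
  have "U \<subseteq> carrier P" by auto
  from isolated_in_subgroup[OF this CSA_U(1,2) \<open>a \<in> U\<close> a(2) iso] show ?thesis by blast
qed

text \<open>
  An element of length zero lies in the intersection, hence in \<open>V\<close>. If it were nontrivial, everything
  commuting with it would lie in \<open>V\<close> by malnormality, but \<open>g\<close> is too long for that.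
\<close>

lemma translation_zero_imp_one:
  assumes g: "g \<in> carrier P" "len g > 1" "\<And>n::nat. len (g [^] n) = n * len g"
    and z: "z \<in> carrier P" "g \<otimes> z = z \<otimes> g" "translation g z 0"
  shows "z = \<one>"
proof (rule ccontr)
  assume "z \<noteq> \<one>"
  have "len z = 0" using len_eq_translation[OF g(1) _ g(3) z] g(2) by simp
  then have "z \<in> V" using z by (simp add: len_eq_0_iff)
  moreover have "conj_by g z = z" using conj_by_eq_self_iff g z by simp
  ultimately have "g \<in> V" using malnormal_V[of z g] \<open>z \<noteq> \<one>\<close> g by simp
  then show False using len_le_1[of g] g(2) by simp
qed

text \<open>
  The translation distance is a homomorphism from the centralizer to the integers, and it is injective; so
  commutators are trivial.
\<close>

lemma hyperbolic_abelian_centralizer: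
  assumes g: "g \<in> carrier P" "len g > 1" "\<And>n::nat. len (g [^] n) = n * len g"
  shows "abelian_centralizer g"
  unfolding abelian_centralizer_def
proof (intro ballI impI)
  fix x y assume x: "x \<in> carrier P" "x \<otimes> g = g \<otimes> x" and y: "y \<in> carrier P" "y \<otimes> g = g \<otimes> y"
  have g0: "len g > 0" using g by simp
  obtain s t where s: "translation g x s" and t: "translation g y t"
    using translation_exists[OF g(1,3)] x y by meson
  have c: "g \<otimes> x = x \<otimes> g" "g \<otimes> y = y \<otimes> g" "g \<otimes> (y \<otimes> x) = y \<otimes> x \<otimes> g"
    using commute_mult[of y x g] x y g by simp_all
  have yx: "translation g (inv (y \<otimes> x)) (- (t + s))"
    using translation_inv[OF g(1) g0 g(3) _ c(3) translation_mult[OF g(1) g0 g(3) _ t _ c(1) s]] x y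
    by simp
  have c': "g \<otimes> inv (y \<otimes> x) = inv (y \<otimes> x) \<otimes> g"
    using commute_inv[of "y \<otimes> x" g] c(3) g x y by simp
  let ?z = "x \<otimes> y \<otimes> inv (y \<otimes> x)"
  have xy: "translation g (x \<otimes> y) (s + t)"
    using translation_mult[OF g(1) g0 g(3) _ s _ c(2) t] x y by simp
  have "translation g ?z (s + t + - (t + s))"
    using translation_mult[OF g(1) g0 g(3) _ xy _ c' yx] x y by simp
  then have z0: "translation g ?z 0" by simp
  have zc: "?z \<in> carrier P" using x(1) y(1) by simp
  have "?z \<otimes> g = g \<otimes> ?z"
    using commute_mult[OF m_closed[OF x(1) y(1)] inv_closed[OF m_closed[OF y(1) x(1)]] g(1)
        commute_mult[OF x(1) y(1) g(1) x(2) y(2)] c'[symmetric]] .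
  then have "?z = \<one>" using translation_zero_imp_one[OF g zc _ z0] by simp
  then show "x \<otimes> y = y \<otimes> x" using x y by (simp add: inv_solve_right' del: inv_mult_group)
qed

lemma elliptic_or_hyperbolic_cases:
  assumes "a \<in> carrier P"
  obtains t where "t \<in> carrier P" "conj_by t a \<in> U \<union> V"
  | t where "t \<in> carrier P" "len (conj_by t a) > 1" "\<And>n::nat. len (conj_by t a [^] n) = n * len (conj_by t a)"
proof -
  obtain t where t: "t \<in> carrier P" "conj_by t a \<in> U \<union> V \<or>
    (\<exists>w. w \<noteq> [] \<and> alt (w @ w) \<and> conj_by t a = word_prod w)"
    using elliptic_or_cyclically_reduced assms by blast
  show thesis
  proof (cases "conj_by t a \<in> U \<union> V")
    case True
    then show ?thesis using that(1) t by blast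
  next
    case False
    then obtain w where w: "w \<noteq> []" "alt (w @ w)" "conj_by t a = word_prod w" using t by blast
    then have "len (word_prod w) = length w"
      by (simp add: len_word_prod alternating_append)
    then show ?thesis
      using that(2)[OF t(1)] len_pow_cyclically_reduced[OF w(1,2)] len_ge_2_cyclically_reduced[OF w(1,2)] w(3)
      by simp
  qed
qed

lemma abelian_centralizer_nontrivial:
  assumes "a \<in> carrier P" "a \<noteq> \<one>"
  shows "abelian_centralizer a"
  using assms(1)
proof (cases rule: elliptic_or_hyperbolic_cases)
  case (1 t)
  then have "conj_by t a \<noteq> \<one>" using conj_by_eq_iff[of t a \<one>] assms by auto
  then show ?thesis using elliptic_element 1 abelian_centralizer_conj_by assms by blast
next
  case (2 t)
  then have "abelian_centralizer (conj_by t a)"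
    using hyperbolic_abelian_centralizer assms by simp
  then show ?thesis using abelian_centralizer_conj_by 2 assms by blast
qed

text \<open>
  An involution is conjugate into a factor, since the powers of cyclically reduced words grow in
  length; and the factors contain none.
\<close>

lemma involution_free_amalgam: "involution_free P (carrier P)"
  unfolding involution_free_def
proof (intro ballI impI)
  fix a assume a: "a \<in> carrier P" "a \<otimes> a = \<one>"
  from a(1) show "a = \<one>"
  proof (cases rule: elliptic_or_hyperbolic_cases)
    case (1 t)
    have "conj_by t a \<otimes> conj_by t a = \<one>" using a 1 by (simp add: conj_by_mult[symmetric])
    then have "conj_by t a = \<one>" using CSA_U(3) CSA_V(3) 1 unfolding involution_free_def by blast
    then show ?thesis using conj_by_eq_iff[of t a \<one>] a 1 by simp
  next
    case (2 t)
    have "conj_by t a [^] (2::nat) = \<one>"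
      using a 2 by (simp add: conj_by_mult[symmetric] numeral_2_eq_2)
    then show ?thesis using 2(2) 2(3)[of 2] len_eq_0_iff[of \<one>] by simp
  qed
qed

text \<open>
  A conjugate of \<open>g\<close> that commutes with \<open>g\<close> translates by the same distance up to sign, so by injectivity
  it is \<open>g\<close> or its inverse. If \<open>x\<close> inverts \<open>g\<close>, then its square commutes with \<open>g\<close>. Either the square is
  trivial, and so is \<open>x\<close> by the absence of involutions, or its centralizer is an abelian group containing
  both \<open>x\<close> and \<open>g\<close>.
\<close>

lemma hyperbolic_separated:
  assumes g: "g \<in> carrier P" "len g > 1" "\<And>n::nat. len (g [^] n) = n * len g"
  shows "separated g"
  unfolding separated_def
proof (intro ballI impI)
  fix x assume x: "x \<in> carrier P" "g \<otimes> conj_by x g = conj_by x g \<otimes> g"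
  let ?b = "conj_by x g"
  have g0: "len g > 0" using g by simp
  obtain t where t: "translation g ?b t" using translation_exists[OF g(1,3), of ?b] x g by auto
  have self: "translation g g (int (len g))" using translation_self g by simp
  have "\<bar>t\<bar> = int (len g)" using conj_translation[OF g(1) g0 g(3) x t] .
  then consider "t = int (len g)" | "t = - int (len g)" by linarith
  then show "x \<otimes> g = g \<otimes> x"
  proof cases
    case 1
    have "translation g (?b \<otimes> inv g) 0"
      using translation_mult[OF g(1) g0 g(3) _ t _ _ translation_inv[OF g(1) g0 g(3) _ _ self]]
        1 g x by simp
    moreover have "g \<otimes> (?b \<otimes> inv g) = ?b \<otimes> inv g \<otimes> g"
      using commute_mult[of ?b "inv g" g] x g by simp
    ultimately have "?b \<otimes> inv g = \<one>" using translation_zero_imp_one[OF g] x g by simp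
    then show ?thesis using conj_by_eq_self_iff[of x g] x g by (simp add: inv_solve_right')
  next
    case 2
    have "translation g (?b \<otimes> g) 0"
      using translation_mult[OF g(1) g0 g(3) _ t _ _ self] 2 g x by simp
    moreover have "g \<otimes> (?b \<otimes> g) = ?b \<otimes> g \<otimes> g"
      using commute_mult[of ?b g g] x g by simp
    ultimately have "?b \<otimes> g = \<one>" using translation_zero_imp_one[OF g, of "?b \<otimes> g"] x g by simp
    then have b: "?b = inv g" using x g by (simp add: inv_equality)
    have "conj_by x (inv g) \<otimes> ?b = \<one>" using conj_by_mult[of x "inv g" g] x g by simp
    then have "conj_by x (inv g) = g" unfolding b using x g by (simp add: inv_solve_right')
    then have "conj_by (x \<otimes> x) g = g" using b x g by (simp add: conj_by_compose[symmetric])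
    then have gx: "x \<otimes> x \<otimes> g = g \<otimes> (x \<otimes> x)" using conj_by_eq_self_iff x g by simp
    show ?thesis
    proof (cases "x \<otimes> x = \<one>")
      case True
      then have "x = \<one>" using involution_free_amalgam x(1) unfolding involution_free_def by blast
      then show ?thesis using g(1) by simp
    next
      case False
      then have "abelian_centralizer (x \<otimes> x)" using abelian_centralizer_nontrivial x by simp
      moreover have "x \<otimes> (x \<otimes> x) = x \<otimes> x \<otimes> x" using x by (simp add: m_assoc)
      ultimately show ?thesis using x g gx unfolding abelian_centralizer_def by metis
    qed
  qed
qed

lemma separated_all:
  assumes "a \<in> carrier P"
  shows "separated a"
proof (cases "a = \<one>")
  case True
  then show ?thesis by (simp add: separated_def)
next
  case False
  from assms show ?thesis
  proof (cases rule: elliptic_or_hyperbolic_cases)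
    case (1 t)
    then have "conj_by t a \<noteq> \<one>" using conj_by_eq_iff[of t a \<one>] assms False by auto
    then show ?thesis using elliptic_element 1 separated_conj_by assms by blast
  next
    case (2 t)
    then have "separated (conj_by t a)" using hyperbolic_separated assms by simp
    then show ?thesis using separated_conj_by 2 assms by blast
  qed
qed

theorem CSA_star: "CSA_star_group P"
  unfolding CSA_star_group_iff
proof (intro conjI involution_free_amalgam)
  show "commutative_transitive P (carrier P)"
    using abelian_centralizer_nontrivial
    unfolding commutative_transitive_def abelian_centralizer_def by blast
  show "conjugation_separated P (carrier P)"
    using separated_all unfolding conjugation_separated_def separated_def conj_by_def by blast
qed

end

section \<open>The normal form action of the amalgamated product\<close>

text \<open>
  The normal form theorem is proved by letting the words act from the right on formal normal forms, lists of
  nontrivial coset representatives followed by an element of the amalgamated subgroup (van der Waerden's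
  trick). This locale treats the action of one factor \<open>K\<close>, so that it serves for both factors: \<open>A\<close> with
  multiplication \<open>mul\<close> is the amalgamated subgroup, \<open>e\<close> its embedding into \<open>K\<close>, and \<open>tag\<close> marks the letters
  from \<open>K\<close>. Lists are stored in reverse, with the letter next to the element of \<open>A\<close> at the head.
\<close>

locale factor_action = K: group K for K :: "('k, 'q) monoid_scheme" +
  fixes A :: "'a set" and mul :: "'a \<Rightarrow> 'a \<Rightarrow> 'a" and e :: "'a \<Rightarrow> 'k" and tag :: "'k \<Rightarrow> 'c"
    and wf :: "'c list \<Rightarrow> bool"
  assumes inj_e: "inj_on e A" and D: "subgroup (e ` A) K"
    and mul_closed: "a \<in> A \<Longrightarrow> b \<in> A \<Longrightarrow> mul a b \<in> A"
    and e_mul: "a \<in> A \<Longrightarrow> b \<in> A \<Longrightarrow> e (mul a b) = e a \<otimes>\<^bsub>K\<^esub> e b"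
    and inj_tag: "inj tag"
    and wf_Cons: "wf (tag r # l) \<longleftrightarrow> r \<in> carrier K - e ` A \<and> K.left_rep (e ` A) r = r \<and> wf l \<and>
      (l = [] \<or> hd l \<notin> range tag)"
begin

text \<open>
  Merge the element of \<open>A\<close> with the adjacent letter, if that letter comes from \<open>K\<close>. This identifies the normal
  forms with pairs of a list not headed by a letter from \<open>K\<close> and an arbitrary element of \<open>K\<close>; \<open>join\<close> is the
  inverse map. On such pairs \<open>K\<close> acts by right multiplication on the second component.
\<close>

definition split :: "'c list \<times> 'a \<Rightarrow> 'c list \<times> 'k" where
  "split \<omega> = (case \<omega> of (l, a) \<Rightarrow>
     if l \<noteq> [] \<and> hd l \<in> range tag then (tl l, the_inv tag (hd l) \<otimes>\<^bsub>K\<^esub> e a) else (l, e a))"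

definition join :: "'c list \<times> 'k \<Rightarrow> 'c list \<times> 'a" where
  "join \<rho> = (case \<rho> of (l, k) \<Rightarrow>
     if k \<in> e ` A then (l, the_inv_into A e k)
     else let r = K.left_rep (e ` A) k in (tag r # l, the_inv_into A e (inv\<^bsub>K\<^esub> r \<otimes>\<^bsub>K\<^esub> k)))"

definition act :: "'k \<Rightarrow> 'c list \<times> 'a \<Rightarrow> 'c list \<times> 'a" where
  "act x \<omega> = (case split \<omega> of (l, k) \<Rightarrow> join (l, k \<otimes>\<^bsub>K\<^esub> x))"

lemma e_carrier [simp]: "a \<in> A \<Longrightarrow> e a \<in> carrier K"
  using subgroup.mem_carrier[OF D] by blast

lemma split_tag [simp]: "split (tag r # l, a) = (l, r \<otimes>\<^bsub>K\<^esub> e a)"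
  by (simp add: split_def the_inv_f_f[OF inj_tag])

lemma split_untagged: "l = [] \<or> hd l \<notin> range tag \<Longrightarrow> split (l, a) = (l, e a)"
  by (auto simp: split_def)

lemma join_base [simp]: "a \<in> A \<Longrightarrow> join (l, e a) = (l, a)"
  by (simp add: join_def the_inv_into_f_f[OF inj_e])

lemma join_coset:
  assumes "k \<in> carrier K" "k \<notin> e ` A"
  obtains r a where "r \<in> carrier K - e ` A" "K.left_rep (e ` A) r = r" "a \<in> A" "k = r \<otimes>\<^bsub>K\<^esub> e a"
    "\<And>l. join (l, k) = (tag r # l, a)"
proof -
  let ?r = "K.left_rep (e ` A) k"
  obtain d where d: "d \<in> e ` A" "?r = k \<otimes>\<^bsub>K\<^esub> d" using K.left_rep_eq[OF D assms(1)] by blast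
  then have dc: "d \<in> carrier K" by auto
  have "inv\<^bsub>K\<^esub> ?r \<otimes>\<^bsub>K\<^esub> k = inv\<^bsub>K\<^esub> d"
    using assms(1) d(2) dc by (simp add: K.inv_mult_group K.m_assoc)
  moreover obtain a where a: "a \<in> A" "inv\<^bsub>K\<^esub> d = e a"
    using subgroup.m_inv_closed[OF D d(1)] by blast
  ultimately have ra: "inv\<^bsub>K\<^esub> ?r \<otimes>\<^bsub>K\<^esub> k = e a" by simp
  have kr: "k = ?r \<otimes>\<^bsub>K\<^esub> e a"
    unfolding a(2)[symmetric] using assms(1) d dc by (simp add: K.m_assoc)
  have "?r \<notin> e ` A"
    using kr assms(2) subgroup.m_closed[OF D, of ?r "e a"] a(1) by auto
  moreover have "?r \<in> carrier K" "K.left_rep (e ` A) ?r = ?r"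
    using assms(1) d dc K.left_rep_mult[OF D assms(1) d(1)] by simp_all
  moreover have "join (l, k) = (tag ?r # l, a)" for l
    using assms(2) ra a(1) by (simp add: join_def Let_def the_inv_into_f_f[OF inj_e])
  ultimately show ?thesis using that a(1) kr by blast
qed

lemma split_join:
  assumes "k \<in> carrier K" "l = [] \<or> hd l \<notin> range tag"
  shows "split (join (l, k)) = (l, k)"
proof (cases "k \<in> e ` A")
  case True
  then show ?thesis using assms(2) by (auto simp: split_untagged)
next
  case False
  then show ?thesis using join_coset[OF assms(1)] by (metis split_tag)
qed

lemma split_wf:
  assumes "wf l" "a \<in> A"
  obtains l' k where "split (l, a) = (l', k)" "wf l'" "k \<in> carrier K" "l' = [] \<or> hd l' \<notin> range tag"
    "join (l', k) = (l, a)"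
proof (cases "l \<noteq> [] \<and> hd l \<in> range tag")
  case False
  then show ?thesis using that[of l "e a"] assms split_untagged by auto
next
  case True
  then obtain r l' where l: "l = tag r # l'" by (cases l) auto
  with assms(1) have r: "r \<in> carrier K" "r \<notin> e ` A" "K.left_rep (e ` A) r = r" "wf l'"
    "l' = [] \<or> hd l' \<notin> range tag" by (auto simp: wf_Cons)
  have k: "r \<otimes>\<^bsub>K\<^esub> e a \<in> carrier K" using r assms(2) by simp
  have "r \<otimes>\<^bsub>K\<^esub> e a \<notin> e ` A"
  proof
    assume "r \<otimes>\<^bsub>K\<^esub> e a \<in> e ` A"
    then have "r \<otimes>\<^bsub>K\<^esub> e a \<otimes>\<^bsub>K\<^esub> inv\<^bsub>K\<^esub> (e a) \<in> e ` A"
      using subgroup.m_closed[OF D] subgroup.m_inv_closed[OF D] assms(2) by blast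
    then show False using r assms(2) by (simp add: K.m_assoc)
  qed
  moreover have "K.left_rep (e ` A) (r \<otimes>\<^bsub>K\<^esub> e a) = r"
    using K.left_rep_mult[OF D r(1)] r(3) assms(2) by simp
  moreover have "inv\<^bsub>K\<^esub> r \<otimes>\<^bsub>K\<^esub> (r \<otimes>\<^bsub>K\<^esub> e a) = e a" using r assms(2) by (simp add: K.cancel_inv_left)
  ultimately have "join (l', r \<otimes>\<^bsub>K\<^esub> e a) = (l, a)"
    using assms(2) by (simp add: join_def l the_inv_into_f_f[OF inj_e])
  then show ?thesis using that[of l' "r \<otimes>\<^bsub>K\<^esub> e a"] r k l by simp
qed

lemma join_wf:
  assumes "wf l" "k \<in> carrier K" "l = [] \<or> hd l \<notin> range tag"
  shows "wf (fst (join (l, k)))" "snd (join (l, k)) \<in> A"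
proof -
  have "wf (fst (join (l, k))) \<and> snd (join (l, k)) \<in> A"
  proof (cases "k \<in> e ` A")
    case True
    then show ?thesis using assms by auto
  next
    case False
    show ?thesis using assms by (rule_tac join_coset[OF assms(2) False]) (auto simp: wf_Cons)
  qed
  then show "wf (fst (join (l, k)))" "snd (join (l, k)) \<in> A" by auto
qed

lemma act_wf:
  assumes "wf (fst \<omega>)" "snd \<omega> \<in> A" "x \<in> carrier K"
  shows "wf (fst (act x \<omega>))" "snd (act x \<omega>) \<in> A"
proof -
  obtain l k where "split \<omega> = (l, k)" "wf l" "k \<in> carrier K" "l = [] \<or> hd l \<notin> range tag"
    using split_wf[OF assms(1,2)] unfolding prod.collapse by blast
  then show "wf (fst (act x \<omega>))" "snd (act x \<omega>) \<in> A"
    using join_wf[of l "k \<otimes>\<^bsub>K\<^esub> x"] assms(3) by (simp_all add: act_def)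
qed

lemma act_mult:
  assumes "wf (fst \<omega>)" "snd \<omega> \<in> A" "x \<in> carrier K" "y \<in> carrier K"
  shows "act y (act x \<omega>) = act (x \<otimes>\<^bsub>K\<^esub> y) \<omega>"
proof -
  obtain l k where "split \<omega> = (l, k)" "k \<in> carrier K" "l = [] \<or> hd l \<notin> range tag"
    using split_wf[OF assms(1,2)] unfolding prod.collapse by blast
  then show ?thesis using assms(3,4) by (simp add: act_def split_join K.m_assoc)
qed

lemma act_one:
  assumes "wf (fst \<omega>)" "snd \<omega> \<in> A"
  shows "act \<one>\<^bsub>K\<^esub> \<omega> = \<omega>"
proof -
  obtain l k where "split \<omega> = (l, k)" "k \<in> carrier K" "join (l, k) = \<omega>"
    using split_wf[OF assms] unfolding prod.collapse by blast
  then show ?thesis by (simp add: act_def)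
qed

text \<open>
  The amalgamated subgroup acts on its own component only, in the same way for both factors. This makes the
  two actions compatible with the identification of its two copies.
\<close>

lemma act_base:
  assumes "wf l" "a \<in> A" "b \<in> A"
  shows "act (e b) (l, a) = (l, mul a b)"
proof (cases "l \<noteq> [] \<and> hd l \<in> range tag")
  case False
  then have "act (e b) (l, a) = join (l, e (mul a b))"
    using split_untagged[of l a] assms by (auto simp: act_def e_mul)
  then show ?thesis using assms by (simp add: mul_closed)
next
  case True
  then obtain r l' where l: "l = tag r # l'" by (cases l) auto
  with assms(1) have r: "r \<in> carrier K" by (simp add: wf_Cons)
  have "split (l, mul a b) = (l', r \<otimes>\<^bsub>K\<^esub> e a \<otimes>\<^bsub>K\<^esub> e b)"
    using r assms by (simp add: l e_mul K.m_assoc)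
  moreover obtain l'' k where "split (l, mul a b) = (l'', k)" "join (l'', k) = (l, mul a b)"
    using split_wf[OF assms(1) mul_closed[OF assms(2,3)]] by blast
  ultimately show ?thesis by (simp add: act_def l)
qed

lemma act_untagged:
  assumes "l = [] \<or> hd l \<notin> range tag" "a \<in> A" "x \<in> carrier K"
  shows "split (act x (l, a)) = (l, e a \<otimes>\<^bsub>K\<^esub> x)"
  using assms by (simp add: act_def split_untagged split_join)

lemma act_new_letter:
  assumes "l = [] \<or> hd l \<notin> range tag" "a \<in> A" "x \<in> carrier K - e ` A"
  shows "\<exists>r. fst (act x (l, a)) = tag r # l"
proof -
  have "e a \<otimes>\<^bsub>K\<^esub> x \<notin> e ` A"
  proof
    assume "e a \<otimes>\<^bsub>K\<^esub> x \<in> e ` A"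
    then have "inv\<^bsub>K\<^esub> (e a) \<otimes>\<^bsub>K\<^esub> (e a \<otimes>\<^bsub>K\<^esub> x) \<in> e ` A"
      using subgroup.m_closed[OF D] subgroup.m_inv_closed[OF D] assms(2) by blast
    then show False using assms(2,3) by (simp add: K.cancel_inv_left)
  qed
  then obtain r b where "\<And>l. join (l, e a \<otimes>\<^bsub>K\<^esub> x) = (tag r # l, b)"
    using join_coset[of "e a \<otimes>\<^bsub>K\<^esub> x"] assms(2,3) by (metis DiffD1 K.m_closed e_carrier)
  then show ?thesis using assms(1) by (auto simp: act_def split_untagged)
qed

end

lemma transfer_image:
  assumes K: "group K" and P: "group P" and f: "f \<in> hom K P" and inj: "inj_on f (carrier K)"
  shows "commutative_transitive K (carrier K) \<Longrightarrow> commutative_transitive P (f ` carrier K)"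
    and "conjugation_separated K (carrier K) \<Longrightarrow> conjugation_separated P (f ` carrier K)"
    and "involution_free K (carrier K) \<Longrightarrow> involution_free P (f ` carrier K)"
proof -
  interpret group_hom K P f using assms by (simp add: group_hom_def group_hom_axioms_def)
  have eq: "f x = f y \<longleftrightarrow> x = y" if "x \<in> carrier K" "y \<in> carrier K" for x y
    using inj that by (auto simp: inj_on_def)
  have one: "f x = \<one>\<^bsub>P\<^esub> \<longleftrightarrow> x = \<one>\<^bsub>K\<^esub>" if "x \<in> carrier K" for x
    using eq[of x "\<one>\<^bsub>K\<^esub>"] that by simp
  have comm: "f x \<otimes>\<^bsub>P\<^esub> f y = f y \<otimes>\<^bsub>P\<^esub> f x \<longleftrightarrow> x \<otimes>\<^bsub>K\<^esub> y = y \<otimes>\<^bsub>K\<^esub> x"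
    if "x \<in> carrier K" "y \<in> carrier K" for x y
    using that eq[of "x \<otimes>\<^bsub>K\<^esub> y" "y \<otimes>\<^bsub>K\<^esub> x"] by simp
  have conj: "f x \<otimes>\<^bsub>P\<^esub> f a \<otimes>\<^bsub>P\<^esub> inv\<^bsub>P\<^esub> (f x) = f (x \<otimes>\<^bsub>K\<^esub> a \<otimes>\<^bsub>K\<^esub> inv\<^bsub>K\<^esub> x)"
    if "x \<in> carrier K" "a \<in> carrier K" for x a
    using that by simp
  show "commutative_transitive P (f ` carrier K)" if ct: "commutative_transitive K (carrier K)"
    unfolding commutative_transitive_def
  proof (intro ballI impI, elim imageE)
    fix a x y a' x' y'
    assume "a = f a'" "x = f x'" "y = f y'" "a' \<in> carrier K" "x' \<in> carrier K" "y' \<in> carrier K"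
      "a \<noteq> \<one>\<^bsub>P\<^esub>" "x \<otimes>\<^bsub>P\<^esub> a = a \<otimes>\<^bsub>P\<^esub> x" "y \<otimes>\<^bsub>P\<^esub> a = a \<otimes>\<^bsub>P\<^esub> y"
    then show "x \<otimes>\<^bsub>P\<^esub> y = y \<otimes>\<^bsub>P\<^esub> x"
      using ct comm one unfolding commutative_transitive_def by metis
  qed
  show "conjugation_separated P (f ` carrier K)" if cs: "conjugation_separated K (carrier K)"
    unfolding conjugation_separated_def
  proof (intro ballI impI, elim imageE)
    fix a x a' x'
    assume *: "a = f a'" "x = f x'" "a' \<in> carrier K" "x' \<in> carrier K"
      and c: "a \<otimes>\<^bsub>P\<^esub> (x \<otimes>\<^bsub>P\<^esub> a \<otimes>\<^bsub>P\<^esub> inv\<^bsub>P\<^esub> x) = x \<otimes>\<^bsub>P\<^esub> a \<otimes>\<^bsub>P\<^esub> inv\<^bsub>P\<^esub> x \<otimes>\<^bsub>P\<^esub> a"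
    have "x' \<otimes>\<^bsub>K\<^esub> a' \<otimes>\<^bsub>K\<^esub> inv\<^bsub>K\<^esub> x' \<in> carrier K" using * by simp
    from comm[OF *(3) this]
    have "a' \<otimes>\<^bsub>K\<^esub> (x' \<otimes>\<^bsub>K\<^esub> a' \<otimes>\<^bsub>K\<^esub> inv\<^bsub>K\<^esub> x') = x' \<otimes>\<^bsub>K\<^esub> a' \<otimes>\<^bsub>K\<^esub> inv\<^bsub>K\<^esub> x' \<otimes>\<^bsub>K\<^esub> a'"
      using c unfolding *(1,2) conj[OF *(4,3)] by blast
    then have "x' \<otimes>\<^bsub>K\<^esub> a' = a' \<otimes>\<^bsub>K\<^esub> x'"
      using cs *(3,4) unfolding conjugation_separated_def by blast
    then show "x \<otimes>\<^bsub>P\<^esub> a = a \<otimes>\<^bsub>P\<^esub> x" unfolding *(1,2) comm[OF *(4,3)] .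
  qed
  show "involution_free P (f ` carrier K)" if inv: "involution_free K (carrier K)"
    unfolding involution_free_def
  proof (intro ballI impI, elim imageE)
    fix x x' assume *: "x = f x'" "x' \<in> carrier K" and "x \<otimes>\<^bsub>P\<^esub> x = \<one>\<^bsub>P\<^esub>"
    then have "x' \<otimes>\<^bsub>K\<^esub> x' = \<one>\<^bsub>K\<^esub>" using one[of "x' \<otimes>\<^bsub>K\<^esub> x'"] by simp
    then have "x' = \<one>\<^bsub>K\<^esub>" using inv *(2) unfolding involution_free_def by blast
    then show "x = \<one>\<^bsub>P\<^esub>" using *(1) by simp
  qed
qed

locale amalgam_over_subgroup = amalgam G H A \<phi>
  for G :: "('a, 'm) monoid_scheme" and H :: "('b, 'n) monoid_scheme" and A :: "'a set" and \<phi> +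
  fixes B :: "'b set"
  assumes A: "subgroup A G" and B: "subgroup B H"
    and \<phi>_iso: "\<phi> \<in> iso (G\<lparr>carrier := A\<rparr>) (H\<lparr>carrier := B\<rparr>)"
begin

lemma \<phi>_image: "\<phi> ` A = B" and \<phi>_inj: "inj_on \<phi> A"
  and \<phi>_mult: "a \<in> A \<Longrightarrow> b \<in> A \<Longrightarrow> \<phi> (a \<otimes>\<^bsub>G\<^esub> b) = \<phi> a \<otimes>\<^bsub>H\<^esub> \<phi> b"
  using \<phi>_iso by (auto simp: iso_def hom_def bij_betw_def)

fun normal_word :: "('a + 'b) list \<Rightarrow> bool" where
  "normal_word [] \<longleftrightarrow> True"
| "normal_word (Inl r # l) \<longleftrightarrow> r \<in> carrier G - A \<and> G.left_rep A r = r \<and> normal_word l \<and>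
     (l = [] \<or> \<not> isl (hd l))"
| "normal_word (Inr r # l) \<longleftrightarrow> r \<in> carrier H - B \<and> H.left_rep B r = r \<and> normal_word l \<and>
     (l = [] \<or> isl (hd l))"

lemma range_Inl: "s \<in> range Inl \<longleftrightarrow> isl s" and range_Inr: "s \<in> range Inr \<longleftrightarrow> \<not> isl s"
  by (cases s; auto)+

sublocale L: factor_action G A "(\<otimes>\<^bsub>G\<^esub>)" "\<lambda>a. a" Inl normal_word
  by (intro factor_action.intro factor_action_axioms.intro G.is_group)
    (use A in \<open>auto simp: subgroup.m_closed range_Inl\<close>)

sublocale R: factor_action H A "(\<otimes>\<^bsub>G\<^esub>)" \<phi> Inr normal_word
  by (intro factor_action.intro factor_action_axioms.intro H.is_group)
    (use A B \<phi>_mult \<phi>_inj in \<open>auto simp: \<phi>_image subgroup.m_closed range_Inr\<close>)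

definition run :: "('a + 'b) list \<Rightarrow> ('a + 'b) list \<times> 'a \<Rightarrow> ('a + 'b) list \<times> 'a" where
  "run = fold (case_sum L.act R.act)"

lemma run_simps [simp]:
  "run [] \<omega> = \<omega>" "run (Inl x # w) \<omega> = run w (L.act x \<omega>)" "run (Inr y # w) \<omega> = run w (R.act y \<omega>)"
  "run (u @ v) \<omega> = run v (run u \<omega>)"
  by (simp_all add: run_def)

definition state :: "('a + 'b) list \<times> 'a \<Rightarrow> bool" where
  "state \<omega> \<longleftrightarrow> normal_word (fst \<omega>) \<and> snd \<omega> \<in> A"

lemma state_run: "w \<in> W \<Longrightarrow> state \<omega> \<Longrightarrow> state (run w \<omega>)"
proof (induction w arbitrary: \<omega>)
  case (Cons s w)
  then show ?case by (cases s) (auto simp: state_def L.act_wf R.act_wf)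
qed simp

text \<open>
  Each defining relation holds for the action, so every element of the amalgamated product has a
  well-defined normal form.
\<close>

lemma run_amalg_eq: "amalg_eq G H A \<phi> u v \<Longrightarrow> state \<omega> \<Longrightarrow> run u \<omega> = run v \<omega>"
proof (induction arbitrary: \<omega> rule: amalg_eq.induct)
  case (append u u' v v')
  then have "u' \<in> W" using amalg_eq_words by blast
  with append show ?case by (simp add: state_run)
next
  case (amalg a)
  then show ?case
    using L.act_base[of "fst \<omega>" "snd \<omega>" a] R.act_base[of "fst \<omega>" "snd \<omega>" a]
    by (simp add: state_def)
qed (auto simp: state_def L.act_one R.act_one L.act_mult R.act_mult)

lemma state_start: "state ([], \<one>\<^bsub>G\<^esub>)"
  using A by (simp add: state_def subgroup.one_closed)

lemma run_start_eq:
  assumes "u \<in> W" "cls u = cls v"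
  shows "run u ([], \<one>\<^bsub>G\<^esub>) = run v ([], \<one>\<^bsub>G\<^esub>)"
  using assms run_amalg_eq state_start by (simp add: cls_eq_iff)

text \<open>
  The number of letters of the normal form. It can be read off from any representing word.
\<close>

definition nf_length :: "('a + 'b) list set \<Rightarrow> nat" where
  "nf_length p = length (fst (run (SOME w. w \<in> p) ([], \<one>\<^bsub>G\<^esub>)))"

lemma nf_length_cls: "w \<in> W \<Longrightarrow> nf_length (cls w) = length (fst (run w ([], \<one>\<^bsub>G\<^esub>)))"
proof -
  assume w: "w \<in> W"
  then have "w \<in> cls w" by (simp add: amalg_class_def amalg_eq.refl)
  then have "(SOME v. v \<in> cls w) \<in> cls w" by (rule someI)
  then have "amalg_eq G H A \<phi> w (SOME v. v \<in> cls w)" by (simp add: amalg_class_def)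
  then show ?thesis unfolding nf_length_def using run_amalg_eq state_start by metis
qed

abbreviation inl :: "'a \<Rightarrow> ('a + 'b) list set" where "inl x \<equiv> cls [Inl x]"

abbreviation inr :: "'b \<Rightarrow> ('a + 'b) list set" where "inr y \<equiv> cls [Inr y]"

abbreviation "U \<equiv> inl ` carrier G"

abbreviation "V \<equiv> inr ` carrier H"

lemma \<phi>_one: "\<phi> \<one>\<^bsub>G\<^esub> = \<one>\<^bsub>H\<^esub>"
proof -
  have "\<one>\<^bsub>G\<^esub> \<in> A" using A by (rule subgroup.one_closed)
  then have "\<phi> \<one>\<^bsub>G\<^esub> \<otimes>\<^bsub>H\<^esub> \<phi> \<one>\<^bsub>G\<^esub> = \<phi> \<one>\<^bsub>G\<^esub>" "\<phi> \<one>\<^bsub>G\<^esub> \<in> carrier H"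
    using \<phi>_mult[of "\<one>\<^bsub>G\<^esub>" "\<one>\<^bsub>G\<^esub>"] \<phi>_closed by auto
  then show ?thesis by (metis H.l_cancel_one)
qed

lemma inl_inj: "inj_on inl (carrier G)"
proof (rule inj_onI)
  fix x y assume xy: "x \<in> carrier G" "y \<in> carrier G" "inl x = inl y"
  have split: "L.split (L.act z ([], \<one>\<^bsub>G\<^esub>)) = ([], z)" if "z \<in> carrier G" for z
    using L.act_untagged[of "[]" "\<one>\<^bsub>G\<^esub>" z] state_start that by (simp add: state_def)
  have "L.act x ([], \<one>\<^bsub>G\<^esub>) = L.act y ([], \<one>\<^bsub>G\<^esub>)"
    using run_start_eq[of "[Inl x]" "[Inl y]"] xy by simp
  then have "([] :: ('a + 'b) list, x) = ([], y)"
    unfolding split[OF xy(1), symmetric] split[OF xy(2), symmetric] by (rule arg_cong)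
  then show "x = y" by simp
qed

lemma inr_inj: "inj_on inr (carrier H)"
proof (rule inj_onI)
  fix x y assume xy: "x \<in> carrier H" "y \<in> carrier H" "inr x = inr y"
  have split: "R.split (R.act z ([], \<one>\<^bsub>G\<^esub>)) = ([], z)" if "z \<in> carrier H" for z
    using R.act_untagged[of "[]" "\<one>\<^bsub>G\<^esub>" z] state_start that by (simp add: state_def \<phi>_one)
  have "R.act x ([], \<one>\<^bsub>G\<^esub>) = R.act y ([], \<one>\<^bsub>G\<^esub>)"
    using run_start_eq[of "[Inr x]" "[Inr y]"] xy by simp
  then have "([] :: ('a + 'b) list, x) = ([], y)"
    unfolding split[OF xy(1), symmetric] split[OF xy(2), symmetric] by (rule arg_cong)
  then show "x = y" by simp
qed

text \<open>
  A letter of \<open>G\<close> outside \<open>A\<close> leaves a trace marked as coming from \<open>G\<close>, which no element of \<open>H\<close> can produce.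
  Hence the two factors meet in \<open>A\<close> only.
\<close>

lemma fst_act_start:
  assumes "x \<in> carrier G" "x \<notin> A" "y \<in> carrier H"
  shows "fst (L.act x ([], \<one>\<^bsub>G\<^esub>)) \<noteq> fst (R.act y ([], \<one>\<^bsub>G\<^esub>))"
proof -
  have 1: "\<one>\<^bsub>G\<^esub> \<in> A" using A by (rule subgroup.one_closed)
  then obtain r where r: "fst (L.act x ([], \<one>\<^bsub>G\<^esub>)) = [Inl r]"
    using L.act_new_letter[of "[]" "\<one>\<^bsub>G\<^esub>" x] assms by auto
  show ?thesis
  proof (cases "y \<in> \<phi> ` A")
    case True
    then show ?thesis using R.act_base[of "[]" "\<one>\<^bsub>G\<^esub>"] 1 r by auto
  next
    case False
    then show ?thesis using R.act_new_letter[of "[]" "\<one>\<^bsub>G\<^esub>" y] 1 r assms(3) by auto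
  qed
qed

lemma inl_mem_V: "x \<in> carrier G \<Longrightarrow> inl x \<in> V \<longleftrightarrow> x \<in> A"
proof
  assume "x \<in> A"
  then show "inl x \<in> V" using inl_eq_inr[of x] \<phi>_closed by auto
next
  assume x: "x \<in> carrier G" "inl x \<in> V"
  then obtain y where "y \<in> carrier H" "inl x = inr y" by blast
  then show "x \<in> A"
    using run_start_eq[of "[Inl x]" "[Inr y]"] fst_act_start[of x y] x by auto
qed

lemma inr_mem_U: "y \<in> carrier H \<Longrightarrow> inr y \<in> U \<longleftrightarrow> y \<in> B"
proof
  assume "y \<in> B"
  then obtain a where "a \<in> A" "y = \<phi> a" using \<phi>_image by blast
  then show "inr y \<in> U" using inl_eq_inr[of a] A_subset by auto
next
  assume y: "y \<in> carrier H" "inr y \<in> U"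
  then obtain x where x: "x \<in> carrier G" "inr y = inl x" by blast
  then have "x \<in> A" using inl_mem_V y by auto
  then have "inr (\<phi> x) = inr y" "\<phi> x \<in> B" using inl_eq_inr[of x] x \<phi>_image by auto
  then have "\<phi> x = y" using inj_onD[OF inr_inj, of "\<phi> x" y] y(1) subgroup.mem_carrier[OF B] by blast
  then show "y \<in> B" using \<open>\<phi> x \<in> B\<close> by simp
qed

text \<open>
  Reading an alternating word from left to right, every letter finds a list headed by a letter of the other
  factor, so it adds one letter to the normal form instead of merging.
\<close>

lemma reduced_word:
  assumes "alternating U V ws"
  shows "\<exists>w\<in>W. monoid.word_prod P ws = cls w \<and>
    length (fst (run w ([], \<one>\<^bsub>G\<^esub>))) = length ws \<and>
    (ws \<noteq> [] \<longrightarrow> (isl (hd (fst (run w ([], \<one>\<^bsub>G\<^esub>)))) \<longleftrightarrow> last ws \<in> U))"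
  using assms
proof (induction ws rule: rev_induct)
  case Nil
  interpret P: group P by (rule group_P)
  show ?case by (intro bexI[of _ "[]"]) (simp_all add: one_P)
next
  case (snoc s ws)
  interpret P: group P by (rule group_P)
  have ws: "alternating U V ws" and s: "s \<in> (U - V) \<union> (V - U)" and
    side: "ws = [] \<or> (last ws \<in> U) \<noteq> (s \<in> U)"
    using snoc.prems by (auto simp: alternating_append alternating_Cons)
  obtain w where w: "w \<in> W" "P.word_prod ws = cls w"
    "length (fst (run w ([], \<one>\<^bsub>G\<^esub>))) = length ws"
    "ws \<noteq> [] \<longrightarrow> (isl (hd (fst (run w ([], \<one>\<^bsub>G\<^esub>)))) \<longleftrightarrow> last ws \<in> U)"
    using snoc.IH ws by blast
  obtain l a where la: "run w ([], \<one>\<^bsub>G\<^esub>) = (l, a)" by fastforce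
  then have a: "a \<in> A" using state_run[OF w(1) state_start] by (simp add: state_def)
  have UVP: "U \<union> V \<subseteq> carrier P" unfolding carrier_P by auto
  have "set ws \<subseteq> carrier P" using ws UVP unfolding alternating_def by blast
  moreover have "s \<in> carrier P" using s UVP by blast
  ultimately have prod: "P.word_prod (ws @ [s]) = cls w \<otimes>\<^bsub>P\<^esub> s"
    using w(2) by (simp add: P.word_prod_append)
  have l: "ws \<noteq> [] \<longrightarrow> (isl (hd l) \<longleftrightarrow> last ws \<in> U)" "length l = length ws" using w la by auto
  show ?case
  proof (cases "s \<in> U")
    case True
    then obtain x where x: "x \<in> carrier G" "s = inl x" by blast
    have "x \<notin> A" using s True x inl_mem_V[OF x(1)] by auto
    have "l = [] \<or> hd l \<notin> range Inl" using l side True by (auto simp: range_Inl)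
    then obtain r where "fst (L.act x (l, a)) = Inl r # l"
      using L.act_new_letter[of l a x] a x \<open>x \<notin> A\<close> by auto
    moreover have "P.word_prod (ws @ [s]) = cls (w @ [Inl x])" "w @ [Inl x] \<in> W"
      using prod x w(1) by (simp_all add: mult_cls)
    ultimately show ?thesis using True la l by (intro bexI[of _ "w @ [Inl x]"]) simp_all
  next
    case False
    then obtain y where y: "y \<in> carrier H" "s = inr y" using s by blast
    have "y \<notin> \<phi> ` A" using s False y inr_mem_U[OF y(1)] \<phi>_image by auto
    have "l = [] \<or> hd l \<notin> range Inr" using l side False by (auto simp: range_Inr)
    then obtain r where "fst (R.act y (l, a)) = Inr r # l"
      using R.act_new_letter[of l a y] a y \<open>y \<notin> \<phi> ` A\<close> by auto
    moreover have "P.word_prod (ws @ [s]) = cls (w @ [Inr y])" "w @ [Inr y] \<in> W"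
      using prod y w(1) by (simp_all add: mult_cls)
    ultimately show ?thesis using False la l by (intro bexI[of _ "w @ [Inr y]"]) simp_all
  qed
qed

lemma decomposition: "amalgam_decomposition P U V nf_length"
proof (intro amalgam_decomposition.intro amalgam_decomposition_axioms.intro group_P)
  interpret P: group P by (rule group_P)
  interpret inl: group_hom G P inl
    using inl_hom by unfold_locales
  interpret inr: group_hom H P inr
    using inr_hom by unfold_locales
  show "subgroup U P" by (rule inl.img_is_subgroup)
  show "subgroup V P" by (rule inr.img_is_subgroup)
  have gen: "cls w \<in> generate P (U \<union> V)" if "w \<in> W" for w
    using that
  proof (induction w)
    case Nil
    then show ?case by (metis generate.one one_P)
  next
    case (Cons s w)
    then have s: "[s] \<in> W" "w \<in> W" by (cases s; simp)+
    have "cls [s] \<in> U \<union> V" using s by (cases s) auto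
    then have "cls [s] \<otimes>\<^bsub>P\<^esub> cls w \<in> generate P (U \<union> V)"
      using Cons.IH s(2) by (blast intro: generate.eng generate.incl)
    then show ?case using s by (simp add: mult_cls)
  qed
  then show "carrier P \<subseteq> generate P (U \<union> V)" by (auto simp: carrier_P)
  fix ws c assume ws: "alternating U V ws" and c: "c \<in> U \<inter> V"
  then obtain x where x: "x \<in> A" "c = inl x" using inl_mem_V A_subset by blast
  obtain w where w: "w \<in> W" "P.word_prod ws = cls w"
    "length (fst (run w ([], \<one>\<^bsub>G\<^esub>))) = length ws"
    using reduced_word[OF ws] by blast
  have "state (run w ([], \<one>\<^bsub>G\<^esub>))" using state_run[OF w(1) state_start] .
  then have "fst (L.act x (run w ([], \<one>\<^bsub>G\<^esub>))) = fst (run w ([], \<one>\<^bsub>G\<^esub>))"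
    using L.act_base[of "fst (run w ([], \<one>\<^bsub>G\<^esub>))" "snd (run w ([], \<one>\<^bsub>G\<^esub>))" x] x(1) by (simp add: state_def)
  moreover have "w @ [Inl x] \<in> W" "P.word_prod ws \<otimes>\<^bsub>P\<^esub> c = cls (w @ [Inl x])"
    using w x A_subset by (auto simp: mult_cls)
  ultimately show "nf_length (P.word_prod ws \<otimes>\<^bsub>P\<^esub> c) = length ws"
    using w(3) by (simp add: nf_length_cls)
qed

text \<open>
  Elements of \<open>K\<close> outside \<open>A\<close> and of \<open>L\<close> outside \<open>B\<close> commute with \<open>a\<close> in the amalgamated product but not
  with each other.
\<close>

lemma not_CSA_star:
  assumes "CSA_star_group P" and K: "comm_subgroup K G" "A \<subset> K" and L: "comm_subgroup L H" "B \<subset> L"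
    and a: "a \<in> A" "a \<noteq> \<one>\<^bsub>G\<^esub>"
  shows False
proof -
  interpret P: amalgam_decomposition P U V nf_length by (rule decomposition)
  obtain x y where x: "x \<in> K" "x \<notin> A" and y: "y \<in> L" "y \<notin> B" using K L by blast
  have xy: "x \<in> carrier G" "y \<in> carrier H" and ac: "a \<in> carrier G" "\<phi> a \<in> carrier H"
    using x y a K(1) L(1) comm_subgroup_commuting A_subset \<phi>_closed by (auto simp: commuting_set_def)
  have "x \<otimes>\<^bsub>G\<^esub> a = a \<otimes>\<^bsub>G\<^esub> x"
    using comm_subgroup_commuting[OF K(1)] K(2) x a by (auto simp: commuting_set_def)
  then have 1: "inl x \<otimes>\<^bsub>P\<^esub> inl a = inl a \<otimes>\<^bsub>P\<^esub> inl x"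
    using hom_mult[OF inl_hom] xy ac by metis
  have "y \<otimes>\<^bsub>H\<^esub> \<phi> a = \<phi> a \<otimes>\<^bsub>H\<^esub> y"
    using comm_subgroup_commuting[OF L(1)] L(2) y a \<phi>_image by (auto simp: commuting_set_def)
  then have 2: "inr y \<otimes>\<^bsub>P\<^esub> inl a = inl a \<otimes>\<^bsub>P\<^esub> inr y"
    using hom_mult[OF inr_hom] xy ac inl_eq_inr[OF a(1)] by metis
  have "inl \<one>\<^bsub>G\<^esub> = \<one>\<^bsub>P\<^esub>" using hom_one[OF inl_hom G.is_group group_P] .
  then have a1: "inl a \<noteq> \<one>\<^bsub>P\<^esub>"
    using inj_onD[OF inl_inj, of a "\<one>\<^bsub>G\<^esub>"] a(2) ac(1) G.one_closed by metis
  have mem: "inl x \<in> U - V" "inr y \<in> V - U"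
    using x(2) y(2) xy inl_mem_V[of x] inr_mem_U[of y] by blast+
  have closed: "inl a \<in> carrier P" "inl x \<in> carrier P" "inr y \<in> carrier P"
    using ac(1) xy by (simp_all add: carrier_P)
  have "commutative_transitive P (carrier P)" using assms(1) P.CSA_star_group_iff by blast
  then have "inl x \<otimes>\<^bsub>P\<^esub> inr y = inr y \<otimes>\<^bsub>P\<^esub> inl x"
    using a1 closed 1 2 unfolding commutative_transitive_def by blast
  then show False using P.not_commute[OF mem] by blast
qed

lemma CSA_amalgamI:
  assumes G: "CSA_star_group G" and H: "CSA_star_group H"
  shows "malnormal A G \<Longrightarrow> CSA_amalgam P U V nf_length"
    and "malnormal B H \<Longrightarrow> CSA_amalgam P V U nf_length"
proof -
  interpret D: amalgam_decomposition P U V nf_length by (rule decomposition)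
  have U: "commutative_transitive P U" "conjugation_separated P U" "involution_free P U"
    using transfer_image[OF G.is_group group_P inl_hom inl_inj] G unfolding G.CSA_star_group_iff by auto
  have V: "commutative_transitive P V" "conjugation_separated P V" "involution_free P V"
    using transfer_image[OF H.is_group group_P inr_hom inr_inj] H unfolding H.CSA_star_group_iff by auto
  interpret inl: group_hom G P inl
    using inl_hom by unfold_locales
  interpret inr: group_hom H P inr
    using inr_hom by unfold_locales
  show "CSA_amalgam P U V nf_length" if mal: "malnormal A G"
  proof (intro CSA_amalgam.intro CSA_amalgam_axioms.intro decomposition U V)
    fix x c assume x: "x \<in> U - V" and c: "c \<in> U \<inter> V" and xc: "group.conj_by P x c \<in> U \<inter> V"
    obtain g a where g: "g \<in> carrier G" "x = inl g" and a: "a \<in> carrier G" "c = inl a"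
      using x c by blast
    have ga: "g \<notin> A" "a \<in> A" using x c g a inl_mem_V by auto
    have "D.conj_by x c = inl (g \<otimes>\<^bsub>G\<^esub> a \<otimes>\<^bsub>G\<^esub> inv\<^bsub>G\<^esub> g)"
      using g a by (simp add: D.conj_by_def)
    with xc have "inl (g \<otimes>\<^bsub>G\<^esub> a \<otimes>\<^bsub>G\<^esub> inv\<^bsub>G\<^esub> g) \<in> V" by (metis IntD1 IntD2)
    then have "g \<otimes>\<^bsub>G\<^esub> a \<otimes>\<^bsub>G\<^esub> inv\<^bsub>G\<^esub> g \<in> A" using inl_mem_V[of "g \<otimes>\<^bsub>G\<^esub> a \<otimes>\<^bsub>G\<^esub> inv\<^bsub>G\<^esub> g"] g(1) a(1) by simp
    then have "a = \<one>\<^bsub>G\<^esub>" using mal g ga unfolding G.malnormal_iff by blast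
    then show "c = \<one>\<^bsub>P\<^esub>" using a by simp
  qed
  show "CSA_amalgam P V U nf_length" if mal: "malnormal B H"
  proof (intro CSA_amalgam.intro CSA_amalgam_axioms.intro D.swap U V)
    fix x c assume x: "x \<in> V - U" and c: "c \<in> V \<inter> U" and xc: "group.conj_by P x c \<in> V \<inter> U"
    obtain g a where g: "g \<in> carrier H" "x = inr g" and a: "a \<in> carrier H" "c = inr a"
      using x c by blast
    have ga: "g \<notin> B" "a \<in> B" using x c g a inr_mem_U by auto
    have "D.conj_by x c = inr (g \<otimes>\<^bsub>H\<^esub> a \<otimes>\<^bsub>H\<^esub> inv\<^bsub>H\<^esub> g)"
      using g a by (simp add: D.conj_by_def)
    with xc have "inr (g \<otimes>\<^bsub>H\<^esub> a \<otimes>\<^bsub>H\<^esub> inv\<^bsub>H\<^esub> g) \<in> U" by (metis IntD1 IntD2)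
    then have "g \<otimes>\<^bsub>H\<^esub> a \<otimes>\<^bsub>H\<^esub> inv\<^bsub>H\<^esub> g \<in> B" using inr_mem_U[of "g \<otimes>\<^bsub>H\<^esub> a \<otimes>\<^bsub>H\<^esub> inv\<^bsub>H\<^esub> g"] g(1) a(1) by simp
    then have "a = \<one>\<^bsub>H\<^esub>" using mal g ga unfolding H.malnormal_iff by blast
    then show "c = \<one>\<^bsub>P\<^esub>" using a by simp
  qed
qed

end

theorem theorem6:
  fixes G :: "('a, 'm) monoid_scheme" and H :: "('b, 'n) monoid_scheme"
    and A :: "'a set" and B :: "'b set" and \<phi> :: "'a \<Rightarrow> 'b"
  assumes "CSA_star_group G" and "CSA_star_group H"
    and "comm_subgroup A G" and "A \<noteq> {\<one>\<^bsub>G\<^esub>}"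
    and "comm_subgroup B H" and "B \<noteq> {\<one>\<^bsub>H\<^esub>}"
    and "\<phi> \<in> iso (G\<lparr>carrier := A\<rparr>) (H\<lparr>carrier := B\<rparr>)"
  shows "CSA_star_group (amalgamated_product G H A \<phi>) \<longleftrightarrow>
    maximal_abelian A G \<or> maximal_abelian B H"
proof -
  have groups: "group G" "group H" using assms(1,2) by (simp_all add: CSA_star_group_def CSA_group_def)
  have AB: "subgroup A G" "subgroup B H" using assms(3,5) by (simp_all add: comm_subgroup_def)
  have "\<phi> ` A = B" using assms(7) by (simp add: iso_def bij_betw_def)
  then interpret amalgam_over_subgroup G H A \<phi> B
    using groups AB assms(7)
    by (intro amalgam_over_subgroup.intro amalgam_over_subgroup_axioms.intro amalgam.intro
        amalgam_axioms.intro) (simp_all add: subgroup.subset)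
  show ?thesis
  proof
    assume P: "CSA_star_group (amalgamated_product G H A \<phi>)"
    obtain a where a: "a \<in> A" "a \<noteq> \<one>\<^bsub>G\<^esub>"
      using assms(4) subgroup.one_closed[OF AB(1)] by blast
    show "maximal_abelian A G \<or> maximal_abelian B H"
    proof (rule ccontr)
      assume "\<not> (maximal_abelian A G \<or> maximal_abelian B H)"
      then obtain K L where "comm_subgroup K G" "A \<subset> K" "comm_subgroup L H" "B \<subset> L"
        using assms(3,5) unfolding maximal_abelian_def by blast
      then show False using not_CSA_star P a by blast
    qed
  next
    assume "maximal_abelian A G \<or> maximal_abelian B H"
    then have "malnormal A G \<or> malnormal B H"
      using assms(1,2) by (auto simp: CSA_star_group_def CSA_group_def)
    then have "CSA_amalgam P U V nf_length \<or> CSA_amalgam P V U nf_length"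
      using CSA_amalgamI assms(1,2) by blast
    then show "CSA_star_group (amalgamated_product G H A \<phi>)"
      using CSA_amalgam.CSA_star by blast
  qed
qed

end
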